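(* Let $p$ be a prime, $n\ge 1$ an integer, and let $F$ be a finite field of characteristic $p$ with $q=p^n$ elements. Let $U(F[C_8\times C_2\times C_2])$ be the unit group of the group algebra $F[C_8\times C_2\times C_2]$. (1) If $p=2$, then $$U(F[C_8\times C_2\times C_2])\cong C_{8}^{n}\times C_{4}^{n}\times C_{2}^{26n}\times C_{2^n-1}.$$ (2) If $p\neq 2$, then $U(F[C_8\times C_2\times C_2])$ is isomorphic to: - $C_{p^n-1}^{32}$, if $q\equiv 1\pmod 8$; - $C_{p^n-1}^{8}\times C_{p^{2n}-1}^{12}$, if $q\equiv -1\pmod 8$; - $C_{p^n-1}^{8}\times C_{p^{2n}-1}^{12}$, if $q\equiv 3\pmod 8$; - $C_{p^n-1}^{16}\times C_{p^{2n}-1}^{8}$, if $q\equiv -3\pmod 8$.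
   Context: $C_m$ denotes the cyclic group of order $m$, and $C_m^k$ denotes the direct product of $k$ copies of $C_m$. For a group $G$ and a field $F$, $FG$ (also written $F[G]$) is the group algebra and $U(FG)$ is the multiplicative group of all its invertible elements. *)

theory Defs
  imports "HOL-Algebra.Algebra" "HOL-Number_Theory.Cong"
begin

(* The elements of the group algebra F[G] are the finitely supported functions
   carrier G -> carrier F, where f stands for the formal sum of the f x * x. They are
   extensional (undefined outside carrier G), so that each formal sum has exactly one
   representative. In the product, the coefficient at x sums f y * g z over all y z = x;
   the sum is restricted to the finite support of f because finsum is only meaningful
   over finite sets. *)
definition group_algebra ::
  "('a, 'm) ring_scheme \<Rightarrow> ('g, 'k) monoid_scheme \<Rightarrow> ('g \<Rightarrow> 'a) ring" where
  "group_algebra F G =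
    \<lparr> carrier = {f \<in> carrier G \<rightarrow>\<^sub>E carrier F. finite {x \<in> carrier G. f x \<noteq> \<zero>\<^bsub>F\<^esub>}},
      monoid.mult = (\<lambda>f g. \<lambda>x\<in>carrier G.
        \<Oplus>\<^bsub>F\<^esub>y\<in>{y \<in> carrier G. f y \<noteq> \<zero>\<^bsub>F\<^esub>}. f y \<otimes>\<^bsub>F\<^esub> g (inv\<^bsub>G\<^esub> y \<otimes>\<^bsub>G\<^esub> x)),
      one = (\<lambda>x\<in>carrier G. if x = \<one>\<^bsub>G\<^esub> then \<one>\<^bsub>F\<^esub> else \<zero>\<^bsub>F\<^esub>),
      ring.zero = (\<lambda>x\<in>carrier G. \<zero>\<^bsub>F\<^esub>),
      ring.add = (\<lambda>f g. \<lambda>x\<in>carrier G. f x \<oplus>\<^bsub>F\<^esub> g x) \<rparr>"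

(* group.ord is 0 for elements of infinite order, which gives characteristic 0. *)
definition ring_characteristic :: "('a, 'm) ring_scheme \<Rightarrow> nat" where
  "ring_characteristic R = group.ord (add_monoid R) \<one>\<^bsub>R\<^esub>"

(* Z/m, written additively; cyclic of order m only for m > 0 (integer_mod_group 0 is Z). *)
abbreviation cyclic :: "nat \<Rightarrow> int monoid" where
  "cyclic m \<equiv> integer_mod_group m"

definition cyclic_power :: "nat \<Rightarrow> nat \<Rightarrow> (nat \<Rightarrow> int) monoid" where
  "cyclic_power m k = product_group {..<k} (\<lambda>_. cyclic m)"

end

theory Submission
  imports Defs
begin

text \<open>
  For \<open>p = 2\<close> squaring is the Frobenius map: it sends \<open>\<Sum> f x * x\<close> to \<open>\<Sum> (f x)\<^sup>2 * x\<^sup>2\<close>. Hence the squares of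
  the normalized units (augmentation 1) supported on a subgroup \<open>S\<close> are exactly the normalized
  units supported on the squares of \<open>S\<close>, and there are \<open>q^(|S| - 1)\<close> normalized units supported on \<open>S\<close>.
  The three successive cardinalities \<open>q^31\<close>, \<open>q^3\<close>, \<open>q\<close> determine the group of normalized units,
  because a basis of the squares of a finite abelian 2-group lifts to a basis of the group.
  The remaining factor is the group of scalars.

  For odd \<open>p\<close> the quadratic extension \<open>K\<close> of \<open>F\<close> contains a primitive 8th root of unity, so all 32
  characters of the group have values in \<open>K\<close>. Evaluating at the characters fixed by the
  conjugation of \<open>K\<close> over \<open>F\<close>, and at one character from each conjugate pair, embeds the group algebra
  into a product of copies of \<open>F\<close> and \<open>K\<close>, and counting elements shows that the embedding is onto.
  Conjugation raises the 8th roots of unity to some power \<open>s\<close>, and \<open>(s - 1) n\<close> and \<open>(q - 1) n\<close> are divisible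
  by 8 for the same \<open>n\<close>, because the nonzero elements of \<open>F\<close> are the roots of \<open>x^(q - 1) = 1\<close> in \<open>K\<close>.
\<close>

section \<open>Bases of finite abelian 2-groups\<close>

text \<open>Conjugation is never identified with the map raising to the power q: only its fixed
  points are determined, and they fix the exponent s only up to exchanging 3 and 7. This is
  harmless, because multiplication by 3 and multiplication by 7 on the integers modulo 8 have
  equally many fixed points and equally many two-element orbits; for the same reason the residues 3
  and -1 of q lead to the same group. The two factors of order 2 do not interact with conjugation,
  since the fourth power of a primitive eighth root of unity is -1. Hence every multiplicity is four
  times a number of orbits modulo 8, for instance 12 = 4 * 3. In characteristic 2 the exponent 26 n
  is what remains of the cardinality after the larger factors: 31 n - 3 n - 2 n. A basis of the
  squares lifts because square roots of its members have twice their orders, and what is still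
  missing differs from the span by elements of order 2, which can be adjoined one at a time.\<close>

definition (in comm_group) lincomb :: "nat \<Rightarrow> (nat \<Rightarrow> 'a) \<Rightarrow> (nat \<Rightarrow> int) \<Rightarrow> 'a" where
  "lincomb k h t = (\<Otimes>i\<in>{..<k}. h i [^] t i)"

text \<open>The conditions together make \<open>m i\<close> the exact order of \<open>h i\<close>
  and the span the direct product of the cyclic groups: an exponent vector gives the identity only
  if it vanishes modulo the \<open>m i\<close>.\<close>

definition (in comm_group) independent :: "nat \<Rightarrow> (nat \<Rightarrow> 'a) \<Rightarrow> (nat \<Rightarrow> nat) \<Rightarrow> bool" where
  "independent k h m \<longleftrightarrow> (\<forall>i<k. h i \<in> carrier G \<and> m i > 0 \<and> h i [^] m i = \<one>) \<and>
     (\<forall>t. lincomb k h t = \<one> \<longrightarrow> (\<forall>i<k. int (m i) dvd t i))"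

definition (in comm_group) basis_of :: "'a set \<Rightarrow> nat \<Rightarrow> (nat \<Rightarrow> 'a) \<Rightarrow> (nat \<Rightarrow> nat) \<Rightarrow> bool" where
  "basis_of H k h m \<longleftrightarrow> independent k h m \<and> H = range (lincomb k h)"

context comm_group
begin

lemma lincomb_closed: "(\<And>i. i < k \<Longrightarrow> h i \<in> carrier G) \<Longrightarrow> lincomb k h t \<in> carrier G"
  unfolding lincomb_def by (rule finprod_closed) auto

lemma lincomb_cong:
  assumes "\<And>i. i < k \<Longrightarrow> h i \<in> carrier G" and "\<And>i. i < k \<Longrightarrow> h i [^] t i = h' i [^] s i"
  shows "lincomb k h t = lincomb k h' s"
  unfolding lincomb_def using assms by (intro finprod_cong') (auto simp: Pi_def simp flip: assms(2))

lemma lincomb_add: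
  assumes "\<And>i. i < k \<Longrightarrow> h i \<in> carrier G"
  shows "lincomb k h (\<lambda>i. t i + s i) = lincomb k h t \<otimes> lincomb k h s"
proof -
  have "lincomb k h (\<lambda>i. t i + s i) = (\<Otimes>i\<in>{..<k}. h i [^] t i \<otimes> h i [^] s i)"
    unfolding lincomb_def using assms by (intro finprod_cong') (auto simp: int_pow_mult)
  also have "\<dots> = lincomb k h t \<otimes> lincomb k h s"
    unfolding lincomb_def using assms by (intro finprod_multf) auto
  finally show ?thesis .
qed

lemma lincomb_zero:
  assumes "\<And>i. i < k \<Longrightarrow> h i \<in> carrier G" and "\<And>i. i < k \<Longrightarrow> h i [^] t i = \<one>"
  shows "lincomb k h t = \<one>"
  unfolding lincomb_def using assms by (intro finprod_one_eqI) auto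

lemma lincomb_uminus:
  assumes "\<And>i. i < k \<Longrightarrow> h i \<in> carrier G"
  shows "lincomb k h (\<lambda>i. - t i) = inv (lincomb k h t)"
proof -
  have "lincomb k h (\<lambda>i. - t i) \<otimes> lincomb k h t = \<one>"
    using lincomb_add[of k h "\<lambda>i. - t i" t] lincomb_zero[of k h "\<lambda>_. 0"] assms by simp
  thus ?thesis using assms by (metis inv_equality lincomb_closed)
qed

lemma lincomb_square:
  assumes "\<And>i. i < k \<Longrightarrow> h i \<in> carrier G"
  shows "lincomb k h t \<otimes> lincomb k h t = lincomb k (\<lambda>i. h i \<otimes> h i) t"
proof -
  have "lincomb k (\<lambda>i. h i \<otimes> h i) t = (\<Otimes>i\<in>{..<k}. h i [^] t i \<otimes> h i [^] t i)"
    unfolding lincomb_def using assms by (intro finprod_cong') (auto simp: int_pow_mult_distrib m_comm)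
  also have "\<dots> = lincomb k h t \<otimes> lincomb k h t"
    unfolding lincomb_def using assms by (intro finprod_multf) auto
  finally show ?thesis by simp
qed

lemma lincomb_Suc:
  assumes "\<And>i. i < Suc k \<Longrightarrow> h i \<in> carrier G"
  shows "lincomb (Suc k) h t = h k [^] t k \<otimes> lincomb k h t"
  unfolding lincomb_def lessThan_Suc using assms by (subst finprod_insert) auto

lemma lincomb_mem:
  assumes "subgroup H G" and "\<And>i. i < k \<Longrightarrow> h i \<in> H"
  shows "lincomb k h t \<in> H"
  using assms(2)
proof (induction k)
  case 0
  then show ?case using assms(1) by (simp add: lincomb_def subgroup.one_closed)
next
  case (Suc k)
  have "lincomb (Suc k) h t = h k [^] t k \<otimes> lincomb k h t"
    using Suc.prems subgroup.subset[OF assms(1)] by (intro lincomb_Suc) auto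
  moreover have "h k [^] t k \<in> H"
    using Suc.prems assms(1) subgroup_int_pow_closed by auto
  ultimately show ?case using Suc assms(1) by (simp add: subgroup.m_closed)
qed

lemma int_pow_cong:
  assumes "x \<in> carrier G" "x [^] (m::nat) = \<one>" "int m dvd a - b"
  shows "x [^] a = x [^] b"
proof -
  obtain c where "a = int m * c + b" using assms(3) by (metis add.commute diff_add_cancel dvd_def add_diff_cancel_right' diff_eq_eq)
  thus ?thesis using assms by (simp add: int_pow_mult int_pow_pow[symmetric] int_pow_int)
qed

text \<open>
  Starting from an independent family whose span contains a square root of every square of \<open>H\<close>, every
  element of \<open>H\<close> outside the span can be corrected to one of order 2, which may then be adjoined.
\<close>

lemma extend_to_basis:
  assumes H: "subgroup H G" "finite H"
    and k: "k0 \<le> k" "independent k h m" "\<And>i. i < k \<Longrightarrow> h i \<in> H"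
    and m: "\<And>i. k0 \<le> i \<Longrightarrow> m i = 2"
    and sq: "\<And>x. x \<in> H \<Longrightarrow> \<exists>t. x \<otimes> x = lincomb k h t \<otimes> lincomb k h t"
  shows "\<exists>r h'. basis_of H (k0 + r) h' m"
  using k sq
\<comment> \<open>Adjoining one element strictly enlarges the span, so the part of \<open>H\<close>
  outside it shrinks while \<open>k\<close> and \<open>h\<close> change.\<close>
proof (induction "card (H - range (lincomb k h))" arbitrary: k h rule: less_induct)
  case less
  note HG = subgroup.subset[OF H(1)]
  have hc: "i < k \<Longrightarrow> h i \<in> carrier G" for i using less.prems(3) HG by auto
  show ?case
  proof (cases "H = range (lincomb k h)")
    case True
    hence "basis_of H (k0 + (k - k0)) h m" using less.prems by (simp add: basis_of_def)
    thus ?thesis by blast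
  next
    case False
    have "range (lincomb k h) \<subseteq> H" using lincomb_mem[OF H(1)] less.prems(3) by auto
    then obtain x where x: "x \<in> H" "x \<notin> range (lincomb k h)" using False by auto
    obtain t where t: "x \<otimes> x = lincomb k h t \<otimes> lincomb k h t" using less.prems(4) x by blast
    define a where "a = x \<otimes> inv (lincomb k h t)"
    have lc: "lincomb k h s \<in> carrier G" for s using lincomb_closed hc by simp
    have xc: "x \<in> carrier G" using x HG by auto
    have aH: "a \<in> H" unfolding a_def using x lincomb_mem[OF H(1)] less.prems(3) H(1)
      by (simp add: subgroup.m_closed subgroup.m_inv_closed)
    hence ac: "a \<in> carrier G" using HG by auto
    have "a \<otimes> a = (x \<otimes> x) \<otimes> inv (lincomb k h t \<otimes> lincomb k h t)"
      unfolding a_def using xc lc by (simp add: inv_mult m_ac)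
    also have "\<dots> = \<one>" using t lc by simp
    finally have a2: "a \<otimes> a = \<one>" .
    have anot: "a \<notin> range (lincomb k h)"
    proof
      assume "a \<in> range (lincomb k h)"
      then obtain s where "a = lincomb k h s" by auto
      hence "x = lincomb k h (\<lambda>i. s i + t i)" unfolding a_def
        using hc lc xc by (metis inv_solve_right' lincomb_add)
      thus False using x by auto
    qed
    define h' where "h' = h(k := a)"
    have hh: "i < Suc k \<Longrightarrow> h' i \<in> carrier G" for i using hc ac by (auto simp: h'_def less_Suc_eq)
    have l': "lincomb (Suc k) h' s = a [^] s k \<otimes> lincomb k h s" for s
    proof -
      have "lincomb k h' s = lincomb k h s" using hc by (intro lincomb_cong) (auto simp: h'_def)
      moreover have "lincomb (Suc k) h' s = h' k [^] s k \<otimes> lincomb k h' s" using hh by (rule lincomb_Suc)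
      ultimately show ?thesis by (simp add: h'_def)
    qed
    have ind: "independent (Suc k) h' m"
      unfolding independent_def
    proof (intro conjI allI impI)
      fix i assume i: "i < Suc k"
      show "h' i \<in> carrier G" using hh i by simp
      show "0 < m i" using less.prems(1,2) m i by (cases "i = k") (auto simp: independent_def less_Suc_eq)
      show "h' i [^] m i = \<one>"
        using less.prems(1,2) m i a2 ac
        by (cases "i = k") (auto simp: independent_def less_Suc_eq h'_def numeral_2_eq_2)
    next
      fix s i assume s: "lincomb (Suc k) h' s = \<one>" and i: "i < Suc k"
      have m2: "m k = 2" using m less.prems(1) by simp
      \<comment> \<open>An odd exponent acts like 1 because \<open>a\<close> squares to the
        identity; the relation would then put \<open>a\<close> into the old span.\<close>
      have e: "even (s k)"
      proof (rule ccontr)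
        assume "odd (s k)"
        hence "a [^] s k = a [^] (1::int)"
          using ac a2 by (intro int_pow_cong[where m=2]) (auto simp: numeral_2_eq_2)
        hence "a \<otimes> lincomb k h s = \<one>" using s l' ac by simp
        hence "a = lincomb k h (\<lambda>i. - s i)"
          using lincomb_uminus hc lc ac by (metis inv_equality inv_inv)
        thus False using anot by auto
      qed
      hence "a [^] s k = a [^] (0::int)"
        using ac a2 by (intro int_pow_cong[where m=2]) (auto simp: numeral_2_eq_2)
      hence "lincomb k h s = \<one>" using s l' ac lc by simp
      hence "\<forall>i<k. int (m i) dvd s i" using less.prems(2) by (auto simp: independent_def)
      thus "int (m i) dvd s i" using e i m2 by (auto simp: less_Suc_eq)
    qed
    have sub: "range (lincomb k h) \<subseteq> range (lincomb (Suc k) h')"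
    proof
      fix y assume "y \<in> range (lincomb k h)"
      then obtain s where "y = lincomb k h s" by auto
      also have "\<dots> = lincomb k h (s(k:=0))" using hc by (intro lincomb_cong) auto
      also have "\<dots> = lincomb (Suc k) h' (s(k:=0))" using l' lc ac by simp
      finally show "y \<in> range (lincomb (Suc k) h')" by auto
    qed
    \<comment> \<open>The exponent vector that is 1 at \<open>k\<close> and 0 elsewhere is invisible
      to \<open>lincomb k\<close> and yields \<open>a\<close> in
      \<open>lincomb (Suc k)\<close>.\<close>
    have "lincomb k h (\<lambda>_. 0) = \<one>" using hc by (intro lincomb_zero) auto
    moreover have "lincomb k h ((\<lambda>_. 0)(k:=1)) = lincomb k h (\<lambda>_. 0)" using hc by (intro lincomb_cong) auto
    ultimately have "lincomb (Suc k) h' ((\<lambda>_. 0)(k:=1)) = a" using l'[of "(\<lambda>_. 0)(k:=1)"] ac by simp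
    hence "a \<in> range (lincomb (Suc k) h')" by (metis rangeI)
    hence "H - range (lincomb (Suc k) h') \<subset> H - range (lincomb k h)" using sub aH anot by auto
    hence "card (H - range (lincomb (Suc k) h')) < card (H - range (lincomb k h))"
      using H(2) by (intro psubset_card_mono) auto
    moreover have "k0 \<le> Suc k" using less.prems(1) by simp
    moreover note ind
    moreover have "i < Suc k \<Longrightarrow> h' i \<in> H" for i
      using less.prems(3) aH by (auto simp: h'_def less_Suc_eq)
    moreover have "\<exists>t. y \<otimes> y = lincomb (Suc k) h' t \<otimes> lincomb (Suc k) h' t" if "y \<in> H" for y
    proof -
      obtain s where s: "y \<otimes> y = lincomb k h s \<otimes> lincomb k h s" using less.prems(4) \<open>y \<in> H\<close> by blast
      have "lincomb k h s \<in> range (lincomb (Suc k) h')" using sub by auto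
      thus ?thesis using s by auto
    qed
    ultimately show ?thesis by (rule less.hyps)
  qed
qed

text \<open>Square roots \<open>g i\<close> of the \<open>h i\<close> have order
  \<open>2 * m i\<close>: squaring a relation among the \<open>g i\<close> gives one among the
  \<open>h i\<close>, so each exponent is a multiple of the even number \<open>m i\<close> and can
  be halved; the halved exponents are again a relation among the \<open>h i\<close>, which supplies
  the extra factor 2. Every square of \<open>H\<close> is now the square of an element of the span,
  as \<open>extend_to_basis\<close> requires.\<close>

lemma basis_of_squares_lift:
  assumes H: "subgroup H G" "finite H"
    and b: "basis_of ((\<lambda>x. x \<otimes> x) ` H) k h m" and ev: "\<And>i. i < k \<Longrightarrow> even (m i)"
  shows "\<exists>r h'. basis_of H (k + r) h' (\<lambda>i. if i < k then 2 * m i else 2)"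
proof -
  note HG = subgroup.subset[OF H(1)]
  let ?m = "\<lambda>i. if i < k then 2 * m i else 2"
  \<comment> \<open>A unit exponent vector shows that \<open>h i\<close> lies in the span of the
    family, which is the set of squares.\<close>
  have hin: "h i \<in> (\<lambda>x. x \<otimes> x) ` H" if "i < k" for i
  proof -
    have hc: "j < k \<Longrightarrow> h j \<in> carrier G" for j using b by (auto simp: basis_of_def independent_def)
    have "(\<Otimes>j\<in>{..<k}. if i = j then h j else \<one>) = h i"
      using that hc by (intro finprod_singleton) auto
    moreover have "lincomb k h (\<lambda>j. if j = i then 1 else 0) = (\<Otimes>j\<in>{..<k}. if i = j then h j else \<one>)"
      unfolding lincomb_def using hc by (intro finprod_cong') (auto)
    ultimately have "h i \<in> range (lincomb k h)" by (metis rangeI)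
    thus ?thesis using b by (simp add: basis_of_def)
  qed
  define g where "g i = (SOME x. x \<in> H \<and> h i = x \<otimes> x)" for i
  have g: "g i \<in> H \<and> h i = g i \<otimes> g i" if "i < k" for i
    unfolding g_def by (rule someI_ex) (use hin[OF that] in auto)
  hence gc: "i < k \<Longrightarrow> g i \<in> carrier G" for i using HG by auto
  have lsq: "lincomb k g t \<otimes> lincomb k g t = lincomb k h t" for t
  proof -
    have "lincomb k g t \<otimes> lincomb k g t = lincomb k (\<lambda>i. g i \<otimes> g i) t" using gc by (intro lincomb_square)
    also have "\<dots> = lincomb k h t" using gc g by (intro lincomb_cong) auto
    finally show ?thesis .
  qed
  have ind: "independent k g ?m"
    unfolding independent_def
  proof (intro conjI allI impI)
    fix i assume i: "i < k"
    show "g i \<in> carrier G" using gc i .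
    show "0 < ?m i" using i b by (auto simp: basis_of_def independent_def)
    have "g i [^] (2 * m i) = h i [^] m i"
      using gc[OF i] g[OF i] by (simp add: nat_pow_distrib nat_pow_mult mult_2)
    thus "g i [^] ?m i = \<one>" using i b by (auto simp: basis_of_def independent_def)
  next
    fix t i assume t: "lincomb k g t = \<one>" and i: "i < k"
    have hind: "lincomb k h s = \<one> \<Longrightarrow> j < k \<Longrightarrow> int (m j) dvd s j" for s j
      using b by (auto simp: basis_of_def independent_def)
    have "lincomb k h t = \<one>" using lsq[of t] t by simp
    hence d: "j < k \<Longrightarrow> int (m j) dvd t j" for j using hind by blast
    define s where "s j = t j div 2" for j
    have ts: "j < k \<Longrightarrow> t j = 2 * s j" for j
      unfolding s_def using d[of j] ev[of j] by (metis dvd_mult_div_cancel dvd_trans even_of_nat_iff)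
    have "lincomb k h s = lincomb k g t"
      using g gc ts unfolding lsq[of s, symmetric]
      by (subst lincomb_add[symmetric]) (auto intro!: lincomb_cong)
    hence "int (m i) dvd s i" using hind t i by simp
    thus "int (?m i) dvd t i" using ts i by simp
  qed
  have "\<exists>t. x \<otimes> x = lincomb k g t \<otimes> lincomb k g t" if "x \<in> H" for x
  proof -
    have "x \<otimes> x \<in> range (lincomb k h)" using that b by (auto simp: basis_of_def)
    thus ?thesis using lsq by auto
  qed
  with extend_to_basis[OF H _ ind, of k] g show ?thesis by auto
qed

lemma basis_of_one: "basis_of {\<one>} 0 h m"
  by (auto simp: basis_of_def independent_def lincomb_def)

text \<open>Elements of the product group are exponent vectors reduced modulo the
  \<open>m i\<close>. Reduction does not change a power of \<open>h i\<close>, which gives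
  multiplicativity and surjectivity; independence makes vectors with equal values congruent, hence
  equal.\<close>

lemma basis_of_iso:
  assumes b: "basis_of H k h m"
  shows "lincomb k h \<in> iso (product_group {..<k} (\<lambda>i. cyclic (m i))) (G\<lparr>carrier := H\<rparr>)"
proof -
  have hc: "i < k \<Longrightarrow> h i \<in> carrier G" and mp: "i < k \<Longrightarrow> m i > 0"
    and hm: "i < k \<Longrightarrow> h i [^] m i = \<one>"
    and hind: "lincomb k h s = \<one> \<Longrightarrow> i < k \<Longrightarrow> int (m i) dvd s i" for s i
    using b by (auto simp: basis_of_def independent_def)
  have red: "lincomb k h (\<lambda>i\<in>{..<k}. t i mod int (m i)) = lincomb k h t" for t
    using hc hm by (intro lincomb_cong) (auto intro!: int_pow_cong[OF hc hm] simp: mod_eq_dvd_iff[symmetric])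
  let ?P = "product_group {..<k} (\<lambda>i. cyclic (m i))"
  have cP: "carrier ?P = (\<Pi>\<^sub>E i\<in>{..<k}. {0..<int (m i)})"
  proof -
    have "carrier (cyclic (m i)) = {0..<int (m i)}" if "i \<in> {..<k}" for i
      using mp[of i] that by (simp add: carrier_integer_mod_group)
    thus ?thesis by (auto intro!: PiE_cong cong: PiE_cong)
  qed
  have "lincomb k h \<in> hom ?P (G\<lparr>carrier := H\<rparr>)"
    unfolding hom_def using b red lincomb_add[OF hc] by (auto simp: basis_of_def)
  moreover have "inj_on (lincomb k h) (carrier ?P)"
  proof (rule inj_onI)
    fix t s assume ts: "t \<in> carrier ?P" "s \<in> carrier ?P" and e: "lincomb k h t = lincomb k h s"
    have "lincomb k h (\<lambda>i. t i + - s i) = \<one>"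
      using lincomb_add[OF hc, where t=t and s="\<lambda>i. - s i"] lincomb_uminus[OF hc, where t=s] e lincomb_closed[OF hc]
      by simp
    hence d: "i < k \<Longrightarrow> int (m i) dvd t i - s i" for i using hind by fastforce
    show "t = s"
    proof (rule PiE_ext)
      show "t \<in> (\<Pi>\<^sub>E i\<in>{..<k}. {0..<int (m i)})" "s \<in> (\<Pi>\<^sub>E i\<in>{..<k}. {0..<int (m i)})"
        using ts cP by auto
      fix i assume i: "i \<in> {..<k}"
      hence "t i \<in> {0..<int (m i)}" "s i \<in> {0..<int (m i)}" using ts cP by (auto simp: PiE_def Pi_def)
      thus "t i = s i" using d[of i] i by (auto simp: mod_eq_dvd_iff[symmetric])
    qed
  qed
  moreover have "lincomb k h ` carrier ?P = H"
  proof -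
    have "x \<in> lincomb k h ` carrier ?P" if "x \<in> H" for x
    proof -
      obtain t where t: "x = lincomb k h t" using b \<open>x \<in> H\<close> by (auto simp: basis_of_def)
      hence "x = lincomb k h (\<lambda>i\<in>{..<k}. t i mod int (m i))" using red by simp
      moreover have "(\<lambda>i\<in>{..<k}. t i mod int (m i)) \<in> carrier ?P" unfolding cP using mp by auto
      ultimately show ?thesis by blast
    qed
    moreover have "lincomb k h ` carrier ?P \<subseteq> H" using b by (auto simp: basis_of_def)
    ultimately show ?thesis by blast
  qed
  ultimately show ?thesis by (simp add: iso_def bij_betw_def)
qed

text \<open>Serves to read off from a known cardinality how many generators of order 2 a lifting has
  adjoined.\<close>

lemma basis_of_card:
  assumes b: "basis_of H k h m"
  shows "card H = (\<Prod>i<k. m i)"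
proof -
  have mp: "i < k \<Longrightarrow> m i > 0" for i using b by (auto simp: basis_of_def independent_def)
  have "bij_betw (lincomb k h) (carrier (product_group {..<k} (\<lambda>i. cyclic (m i)))) H"
    using basis_of_iso[OF b] by (simp add: iso_def)
  hence "card H = card (carrier (product_group {..<k} (\<lambda>i. cyclic (m i))))"
    by (simp add: bij_betw_same_card)
  also have "\<dots> = (\<Prod>i<k. card (carrier (cyclic (m i))))" by (simp add: card_PiE)
  also have "\<dots> = (\<Prod>i<k. m i)" using mp by (intro prod.cong) (auto simp: carrier_integer_mod_group)
  finally show ?thesis .
qed

end

section \<open>Group algebras of finite abelian groups\<close>

lemma (in abelian_monoid) finsum_swap:
  assumes "finite A" "finite B" "\<And>x y. x \<in> A \<Longrightarrow> y \<in> B \<Longrightarrow> f x y \<in> carrier G"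
  shows "(\<Oplus>x\<in>A. \<Oplus>y\<in>B. f x y) = (\<Oplus>y\<in>B. \<Oplus>x\<in>A. f x y)"
  using assms(1,3)
proof (induction A rule: finite_induct)
  case empty
  then show ?case by (simp add: finsum_zero)
next
  case (insert a A)
  have "(\<Oplus>y\<in>B. \<Oplus>x\<in>insert a A. f x y) = (\<Oplus>y\<in>B. f a y \<oplus> (\<Oplus>x\<in>A. f x y))"
    using insert by (intro finsum_cong') (auto intro!: finsum_insert finsum_closed)
  also have "\<dots> = (\<Oplus>y\<in>B. f a y) \<oplus> (\<Oplus>y\<in>B. \<Oplus>x\<in>A. f x y)"
    using insert by (intro finsum_addf) (auto intro!: finsum_closed)
  also have "\<dots> = (\<Oplus>x\<in>insert a A. \<Oplus>y\<in>B. f x y)"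
    using insert by (subst finsum_insert) (auto intro!: finsum_closed)
  finally show ?case by simp
qed

lemma (in semiring) finsum_indicator:
  assumes "finite A" "x \<in> A" "f \<in> A \<rightarrow> carrier R"
  shows "(\<Oplus>y\<in>A. f y \<otimes> (if y = x then \<one> else \<zero>)) = f x"
proof -
  have "(\<Oplus>y\<in>A. f y \<otimes> (if y = x then \<one> else \<zero>)) = (\<Oplus>y\<in>A. if x = y then f y else \<zero>)"
    using assms by (intro finsum_cong') (auto simp: Pi_def)
  also have "\<dots> = f x" using assms by (intro add.finprod_singleton) auto
  finally show ?thesis .
qed

locale finite_group_algebra = R?: cring R + G?: comm_group G
  for R (structure) and G (structure) +
  assumes finite_G: "finite (carrier G)"
begin

abbreviation "RG \<equiv> group_algebra R G"

text \<open>The linear functional with value \<open>w x\<close> at the group element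
  \<open>x\<close>. Convolution is awkward to rewrite coefficientwise because its formula contains
  inverses; tested against arbitrary \<open>w\<close> it becomes a sum over pairs. Coefficients, the
  augmentation and the characters all arise from special \<open>w\<close>.\<close>

definition "pairing f w = (\<Oplus>x\<in>carrier G. f x \<otimes> w x)"

lemma carrier_RG: "carrier RG = (carrier G \<rightarrow>\<^sub>E carrier R)"
  using finite_G by (auto simp: group_algebra_def)

lemma RG_mem: "f \<in> carrier RG \<Longrightarrow> x \<in> carrier G \<Longrightarrow> f x \<in> carrier R"
  by (auto simp: carrier_RG)

lemma pairing_closed:
  "f \<in> carrier RG \<Longrightarrow> w \<in> carrier G \<rightarrow> carrier R \<Longrightarrow> pairing f w \<in> carrier R"
  unfolding pairing_def by (intro finsum_closed) (auto simp: RG_mem)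

lemma pairing_cong:
  assumes "f \<in> carrier RG" "w \<in> carrier G \<rightarrow> carrier R" "\<And>x. x \<in> carrier G \<Longrightarrow> w x = w' x"
  shows "pairing f w = pairing f w'"
proof -
  have "x \<in> carrier G \<Longrightarrow> w' x = w x" for x using assms(3) by simp
  thus ?thesis unfolding pairing_def using assms(1,2) by (intro finsum_cong') (auto simp: RG_mem Pi_def)
qed

text \<open>Terms outside the support of \<open>f\<close> vanish, so the sum may run over the whole
  finite group; its index set no longer depends on \<open>f\<close>, and sums can be
  exchanged.\<close>

lemma RG_mult:
  assumes "f \<in> carrier RG" "g \<in> carrier RG"
  shows "f \<otimes>\<^bsub>RG\<^esub> g = (\<lambda>x\<in>carrier G. \<Oplus>y\<in>carrier G. f y \<otimes> g (inv\<^bsub>G\<^esub> y \<otimes>\<^bsub>G\<^esub> x))"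
proof -
  have "(\<Oplus>y\<in>{y \<in> carrier G. f y \<noteq> \<zero>}. f y \<otimes> g (inv\<^bsub>G\<^esub> y \<otimes>\<^bsub>G\<^esub> x)) =
     (\<Oplus>y\<in>carrier G. f y \<otimes> g (inv\<^bsub>G\<^esub> y \<otimes>\<^bsub>G\<^esub> x))" if "x \<in> carrier G" for x
    using finite_G assms that by (intro add.finprod_mono_neutral_cong_left) (auto simp: RG_mem)
  thus ?thesis by (auto simp: group_algebra_def fun_eq_iff)
qed

lemma RG_mult_closed:
  assumes "f \<in> carrier RG" "g \<in> carrier RG"
  shows "f \<otimes>\<^bsub>RG\<^esub> g \<in> carrier RG"
  unfolding RG_mult[OF assms] carrier_RG using assms
  by (auto intro!: finsum_closed simp: RG_mem)

lemma RG_one: "\<one>\<^bsub>RG\<^esub> = (\<lambda>x\<in>carrier G. if x = \<one>\<^bsub>G\<^esub> then \<one> else \<zero>)"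
  by (simp add: group_algebra_def)

text \<open>After the exchange of sums, substituting the product of \<open>y\<close> and
  \<open>z\<close> for \<open>x\<close>, with \<open>y\<close> held fixed, removes the inverse from
  the convolution.\<close>

lemma pairing_mult:
  assumes f: "f \<in> carrier RG" and g: "g \<in> carrier RG" and w: "w \<in> carrier G \<rightarrow> carrier R"
  shows "pairing (f \<otimes>\<^bsub>RG\<^esub> g) w = (\<Oplus>y\<in>carrier G. f y \<otimes> pairing g (\<lambda>z. w (y \<otimes>\<^bsub>G\<^esub> z)))"
proof -
  have wc: "x \<in> carrier G \<Longrightarrow> w x \<in> carrier R" for x using w by auto
  note cl = RG_mem[OF f] RG_mem[OF g] wc
  have "pairing (f \<otimes>\<^bsub>RG\<^esub> g) w =
     (\<Oplus>x\<in>carrier G. \<Oplus>y\<in>carrier G. f y \<otimes> (g (inv\<^bsub>G\<^esub> y \<otimes>\<^bsub>G\<^esub> x) \<otimes> w x))"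
    unfolding pairing_def RG_mult[OF f g] using finite_G cl
    by (intro finsum_cong')
       (auto simp: finsum_ldistr Pi_def R.m_assoc intro!: finsum_closed finsum_cong')
  also have "\<dots> = (\<Oplus>y\<in>carrier G. \<Oplus>x\<in>carrier G. f y \<otimes> (g (inv\<^bsub>G\<^esub> y \<otimes>\<^bsub>G\<^esub> x) \<otimes> w x))"
    using finite_G cl by (intro finsum_swap) auto
  also have "\<dots> = (\<Oplus>y\<in>carrier G. f y \<otimes> pairing g (\<lambda>z. w (y \<otimes>\<^bsub>G\<^esub> z)))"
  proof (intro finsum_cong' refl)
    show "(\<lambda>y. f y \<otimes> pairing g (\<lambda>z. w (y \<otimes>\<^bsub>G\<^esub> z))) \<in> carrier G \<rightarrow> carrier R"
      using cl g by (auto intro!: pairing_closed)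
    fix y assume y: "y \<in> carrier G"
    have bij: "(\<lambda>z. y \<otimes>\<^bsub>G\<^esub> z) ` carrier G = carrier G" "inj_on (\<lambda>z. y \<otimes>\<^bsub>G\<^esub> z) (carrier G)"
      using y G.surj_const_mult G.inj_on_multc G.inj_on_cmult by auto
    have "(\<Oplus>x\<in>carrier G. f y \<otimes> (g (inv\<^bsub>G\<^esub> y \<otimes>\<^bsub>G\<^esub> x) \<otimes> w x)) =
       (\<Oplus>x\<in>(\<lambda>z. y \<otimes>\<^bsub>G\<^esub> z) ` carrier G. f y \<otimes> (g (inv\<^bsub>G\<^esub> y \<otimes>\<^bsub>G\<^esub> x) \<otimes> w x))"
      using bij by simp
    also have "\<dots> = (\<Oplus>z\<in>carrier G. f y \<otimes> (g (inv\<^bsub>G\<^esub> y \<otimes>\<^bsub>G\<^esub> (y \<otimes>\<^bsub>G\<^esub> z)) \<otimes> w (y \<otimes>\<^bsub>G\<^esub> z)))"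
      using bij y cl by (intro finsum_reindex) auto
    also have "\<dots> = (\<Oplus>z\<in>carrier G. f y \<otimes> (g z \<otimes> w (y \<otimes>\<^bsub>G\<^esub> z)))"
      using y cl by (intro finsum_cong') (auto simp: G.m_assoc[symmetric])
    also have "\<dots> = f y \<otimes> pairing g (\<lambda>z. w (y \<otimes>\<^bsub>G\<^esub> z))"
      unfolding pairing_def using y cl finite_G by (intro finsum_rdistr[symmetric]) auto
    finally show "(\<Oplus>x\<in>carrier G. f y \<otimes> (g (inv\<^bsub>G\<^esub> y \<otimes>\<^bsub>G\<^esub> x) \<otimes> w x)) = f y \<otimes> pairing g (\<lambda>z. w (y \<otimes>\<^bsub>G\<^esub> z))" .
  qed
  finally show ?thesis .
qed

text \<open>The group element \<open>x\<close> inside the group algebra; used as a test function it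
  extracts the coefficient at \<open>x\<close>.\<close>

definition "delta x = (\<lambda>y\<in>carrier G. if y = x then \<one> else \<zero>)"

lemma delta_closed: "delta x \<in> carrier RG"
  by (auto simp: delta_def carrier_RG)

lemma delta_fun: "delta x \<in> carrier G \<rightarrow> carrier R"
  by (auto simp: delta_def)

lemma pairing_delta: "f \<in> carrier RG \<Longrightarrow> x \<in> carrier G \<Longrightarrow> pairing f (delta x) = f x"
  unfolding pairing_def
  by (subst finsum_indicator[OF finite_G, of x f, symmetric])
     (auto simp: delta_def RG_mem intro!: finsum_cong')

lemma RG_eqI:
  assumes "f \<in> carrier RG" "g \<in> carrier RG" "\<And>x. x \<in> carrier G \<Longrightarrow> f x = g x"
  shows "f = g"
  using assms unfolding carrier_RG by (intro PiE_ext) auto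

lemma RG_eqI_pairing:
  assumes "f \<in> carrier RG" "g \<in> carrier RG"
    "\<And>w. w \<in> carrier G \<rightarrow> carrier R \<Longrightarrow> pairing f w = pairing g w"
  shows "f = g"
proof (rule RG_eqI[OF assms(1,2)])
  fix x assume x: "x \<in> carrier G"
  show "f x = g x"
    using assms(3)[OF delta_fun[of x]] pairing_delta[OF assms(1) x] pairing_delta[OF assms(2) x] by simp
qed

text \<open>In this form the roles of \<open>f\<close> and \<open>g\<close> can be exchanged;
  commutativity and the collapse of squares in characteristic 2 are both read off from it.\<close>

lemma pairing_mult_double:
  assumes f: "f \<in> carrier RG" and g: "g \<in> carrier RG" and w: "w \<in> carrier G \<rightarrow> carrier R"
  shows "pairing (f \<otimes>\<^bsub>RG\<^esub> g) w = (\<Oplus>y\<in>carrier G. \<Oplus>z\<in>carrier G. f y \<otimes> (g z \<otimes> w (y \<otimes>\<^bsub>G\<^esub> z)))"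
proof -
  have wc: "x \<in> carrier G \<Longrightarrow> w x \<in> carrier R" for x using w by auto
  note cl = RG_mem[OF f] RG_mem[OF g] wc
  show ?thesis unfolding pairing_mult[OF assms] unfolding pairing_def using cl finite_G
    by (intro finsum_cong') (auto simp: finsum_rdistr Pi_def intro!: finsum_closed)
qed

lemma RG_mult_comm:
  assumes f: "f \<in> carrier RG" and g: "g \<in> carrier RG"
  shows "f \<otimes>\<^bsub>RG\<^esub> g = g \<otimes>\<^bsub>RG\<^esub> f"
proof (rule RG_eqI_pairing)
  fix w assume w: "w \<in> carrier G \<rightarrow> carrier R"
  have wc: "x \<in> carrier G \<Longrightarrow> w x \<in> carrier R" for x using w by auto
  note cl = RG_mem[OF f] RG_mem[OF g] wc
  have "pairing (f \<otimes>\<^bsub>RG\<^esub> g) w = (\<Oplus>z\<in>carrier G. \<Oplus>y\<in>carrier G. f y \<otimes> (g z \<otimes> w (y \<otimes>\<^bsub>G\<^esub> z)))"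
    unfolding pairing_mult_double[OF f g w] using finite_G cl by (intro finsum_swap) auto
  also have "\<dots> = pairing (g \<otimes>\<^bsub>RG\<^esub> f) w"
    unfolding pairing_mult_double[OF g f w] using finite_G cl
    by (intro finsum_cong') (auto simp: R.m_lcomm G.m_comm intro!: finsum_closed finsum_cong')
  finally show "pairing (f \<otimes>\<^bsub>RG\<^esub> g) w = pairing (g \<otimes>\<^bsub>RG\<^esub> f) w" .
qed (use assms RG_mult_closed in auto)

text \<open>Against a test function both sides become the triple sum of \<open>f a\<close>,
  \<open>g b\<close>, \<open>h z\<close> and \<open>w\<close> at the product of \<open>a\<close>,
  \<open>b\<close> and \<open>z\<close>, so only associativity of \<open>G\<close> is left.\<close>

lemma RG_mult_assoc:
  assumes f: "f \<in> carrier RG" and g: "g \<in> carrier RG" and h: "h \<in> carrier RG"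
  shows "(f \<otimes>\<^bsub>RG\<^esub> g) \<otimes>\<^bsub>RG\<^esub> h = f \<otimes>\<^bsub>RG\<^esub> (g \<otimes>\<^bsub>RG\<^esub> h)"
proof (rule RG_eqI_pairing)
  fix w assume w: "w \<in> carrier G \<rightarrow> carrier R"
  have wc: "x \<in> carrier G \<Longrightarrow> w x \<in> carrier R" for x using w by auto
  note cl = RG_mem[OF f] RG_mem[OF g] RG_mem[OF h] wc
  have wy: "(\<lambda>z. w (y \<otimes>\<^bsub>G\<^esub> z)) \<in> carrier G \<rightarrow> carrier R" if "y \<in> carrier G" for y using that wc by auto
  have pc: "pairing h (\<lambda>z. w (y \<otimes>\<^bsub>G\<^esub> z)) \<in> carrier R" if "y \<in> carrier G" for y
    using that wy h pairing_closed by auto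
  \<comment> \<open>The right-hand side is again a pairing, with the inner pairing of
    \<open>h\<close> as its test function, so \<open>pairing_mult\<close> can be applied a second
    time.\<close>
  have "pairing ((f \<otimes>\<^bsub>RG\<^esub> g) \<otimes>\<^bsub>RG\<^esub> h) w = pairing (f \<otimes>\<^bsub>RG\<^esub> g) (\<lambda>y. pairing h (\<lambda>z. w (y \<otimes>\<^bsub>G\<^esub> z)))"
    unfolding pairing_mult[OF RG_mult_closed[OF f g] h w] by (simp add: pairing_def)
  also have "\<dots> = (\<Oplus>a\<in>carrier G. f a \<otimes> pairing g (\<lambda>b. pairing h (\<lambda>z. w ((a \<otimes>\<^bsub>G\<^esub> b) \<otimes>\<^bsub>G\<^esub> z))))"
    using f g pc by (intro pairing_mult) auto
  also have "\<dots> = (\<Oplus>a\<in>carrier G. f a \<otimes> pairing (g \<otimes>\<^bsub>RG\<^esub> h) (\<lambda>z. w (a \<otimes>\<^bsub>G\<^esub> z)))"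
  proof (intro finsum_cong' refl)
    fix a assume a: "a \<in> carrier G"
    have "pairing (g \<otimes>\<^bsub>RG\<^esub> h) (\<lambda>z. w (a \<otimes>\<^bsub>G\<^esub> z)) =
        pairing g (\<lambda>b. pairing h (\<lambda>z. w (a \<otimes>\<^bsub>G\<^esub> (b \<otimes>\<^bsub>G\<^esub> z))))"
      unfolding pairing_mult[OF g h wy[OF a]] by (simp add: pairing_def)
    also have "\<dots> = pairing g (\<lambda>b. pairing h (\<lambda>z. w ((a \<otimes>\<^bsub>G\<^esub> b) \<otimes>\<^bsub>G\<^esub> z)))"
      using a wc by (intro pairing_cong g) (auto intro!: pairing_closed pairing_cong h simp: G.m_assoc)
    finally show "f a \<otimes> pairing g (\<lambda>b. pairing h (\<lambda>z. w ((a \<otimes>\<^bsub>G\<^esub> b) \<otimes>\<^bsub>G\<^esub> z))) =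
       f a \<otimes> pairing (g \<otimes>\<^bsub>RG\<^esub> h) (\<lambda>z. w (a \<otimes>\<^bsub>G\<^esub> z))" by simp
  qed (use cl wy g h in \<open>auto intro!: pairing_closed RG_mult_closed\<close>)
  also have "\<dots> = pairing (f \<otimes>\<^bsub>RG\<^esub> (g \<otimes>\<^bsub>RG\<^esub> h)) w"
    using pairing_mult[OF f RG_mult_closed[OF g h] w] by simp
  finally show "pairing ((f \<otimes>\<^bsub>RG\<^esub> g) \<otimes>\<^bsub>RG\<^esub> h) w = pairing (f \<otimes>\<^bsub>RG\<^esub> (g \<otimes>\<^bsub>RG\<^esub> h)) w" .
qed (use assms RG_mult_closed in auto)

lemma RG_one_closed: "\<one>\<^bsub>RG\<^esub> \<in> carrier RG"
  by (auto simp: RG_one carrier_RG)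

lemma RG_one_delta: "\<one>\<^bsub>RG\<^esub> = delta \<one>\<^bsub>G\<^esub>"
  by (auto simp: RG_one delta_def)

lemma RG_mult_delta:
  assumes f: "f \<in> carrier RG" and a: "a \<in> carrier G" and x: "x \<in> carrier G"
  shows "(f \<otimes>\<^bsub>RG\<^esub> delta a) x = f (x \<otimes>\<^bsub>G\<^esub> inv\<^bsub>G\<^esub> a)"
proof -
  have "(f \<otimes>\<^bsub>RG\<^esub> delta a) x = (\<Oplus>y\<in>carrier G. f y \<otimes> (if y = x \<otimes>\<^bsub>G\<^esub> inv\<^bsub>G\<^esub> a then \<one> else \<zero>))"
  proof -
    have "inv\<^bsub>G\<^esub> y \<otimes>\<^bsub>G\<^esub> x = a \<longleftrightarrow> y = x \<otimes>\<^bsub>G\<^esub> inv\<^bsub>G\<^esub> a" if "y \<in> carrier G" for y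
      using that a x by (metis G.inv_solve_left G.inv_solve_right G.m_comm G.inv_closed G.m_closed)
    thus ?thesis unfolding RG_mult[OF f delta_closed] using x f
      by (auto intro!: finsum_cong' simp: delta_def RG_mem)
  qed
  also have "\<dots> = f (x \<otimes>\<^bsub>G\<^esub> inv\<^bsub>G\<^esub> a)"
    using finite_G a x f by (intro finsum_indicator) (auto simp: RG_mem)
  finally show ?thesis .
qed

lemma RG_comm_monoid: "comm_monoid RG"
proof (rule comm_monoidI)
  fix f assume f: "f \<in> carrier RG"
  show "\<one>\<^bsub>RG\<^esub> \<otimes>\<^bsub>RG\<^esub> f = f"
    unfolding RG_mult_comm[OF RG_one_closed f] using f
    by (intro RG_eqI RG_mult_closed RG_one_closed) (simp_all add: RG_one_delta RG_mult_delta)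
next
  fix f g assume "f \<in> carrier RG" "g \<in> carrier RG"
  thus "f \<otimes>\<^bsub>RG\<^esub> g = g \<otimes>\<^bsub>RG\<^esub> f" by (rule RG_mult_comm)
qed (simp_all add: RG_mult_closed RG_one_closed RG_mult_assoc)

end

text \<open>Off the diagonal the equal terms \<open>s x y\<close> and \<open>s y x\<close> cancel in
  pairs.\<close>

lemma (in cring) finsum_symmetric_diagonal:
  assumes "finite A" and s: "\<And>x y. x \<in> A \<Longrightarrow> y \<in> A \<Longrightarrow> s x y \<in> carrier R"
    and sym: "\<And>x y. x \<in> A \<Longrightarrow> y \<in> A \<Longrightarrow> s x y = s y x"
    and dbl: "\<And>x. x \<in> carrier R \<Longrightarrow> x \<oplus> x = \<zero>"
  shows "(\<Oplus>x\<in>A. \<Oplus>y\<in>A. s x y) = (\<Oplus>x\<in>A. s x x)"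
  using assms(1-3)
proof (induction A rule: finite_induct)
  case empty
  then show ?case by (simp add: finsum_empty)
next
  case (insert a A)
  define T where "T = (\<Oplus>y\<in>A. s a y)"
  define D where "D = (\<Oplus>x\<in>A. s x x)"
  have sc: "s x y \<in> carrier R" if "x \<in> insert a A" "y \<in> insert a A" for x y using insert.prems that by blast
  have TD: "T \<in> carrier R" "D \<in> carrier R" using sc by (auto simp: T_def D_def intro!: finsum_closed)
  have IH: "(\<Oplus>x\<in>A. \<Oplus>y\<in>A. s x y) = D" unfolding D_def using insert by auto
  have "(\<Oplus>x\<in>insert a A. \<Oplus>y\<in>insert a A. s x y) = (\<Oplus>x\<in>insert a A. s x a \<oplus> (\<Oplus>y\<in>A. s x y))"
    using insert.hyps sc by (intro finsum_cong') (auto intro!: finsum_insert finsum_closed)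
  also have "\<dots> = (s a a \<oplus> T) \<oplus> (\<Oplus>x\<in>A. s x a \<oplus> (\<Oplus>y\<in>A. s x y))"
    unfolding T_def using insert.hyps sc by (intro finsum_insert) (auto intro!: finsum_closed)
  also have "(\<Oplus>x\<in>A. s x a \<oplus> (\<Oplus>y\<in>A. s x y)) = (\<Oplus>x\<in>A. s x a) \<oplus> (\<Oplus>x\<in>A. \<Oplus>y\<in>A. s x y)"
    using sc by (intro finsum_addf) (auto intro!: finsum_closed)
  also have "(\<Oplus>x\<in>A. s x a) = T"
    unfolding T_def using sc insert.prems(2) by (intro finsum_cong') auto
  \<comment> \<open>\<open>T\<close> occurs once as the new row and once as the new column, and
    doubles vanish.\<close>
  also have "(s a a \<oplus> T) \<oplus> (T \<oplus> (\<Oplus>x\<in>A. \<Oplus>y\<in>A. s x y)) = (T \<oplus> T) \<oplus> (s a a \<oplus> D)"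
    unfolding IH using TD sc by (simp add: a_ac)
  also have "\<dots> = s a a \<oplus> D" using dbl TD sc by simp
  also have "\<dots> = (\<Oplus>x\<in>insert a A. s x x)"
    unfolding D_def using insert.hyps sc by (intro finsum_insert[symmetric]) auto
  finally show ?case .
qed

section \<open>Multiplicative groups of finite fields\<close>

lemma (in field) units_generator:
  assumes "finite (carrier R)"
  shows "\<exists>a\<in>Units R. group.ord (units_of R) a = card (carrier R) - 1"
proof -
  have M: "Multiplicative_Group.mult_of R = units_of R" by (rule mult_of_is_Units)
  interpret U: group "units_of R" by (rule units_group)
  obtain a where a: "a \<in> carrier (Multiplicative_Group.mult_of R)"
    and gen: "carrier (Multiplicative_Group.mult_of R) = {a [^] i | i::nat. i \<in> UNIV}"
    using finite_field_mult_group_has_gen[OF assms] by (elim bexE)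
  have aU: "a \<in> carrier (units_of R)" using a unfolding M .
  have fin: "finite (carrier (units_of R))" using assms by (simp flip: M)
  have "{a [^]\<^bsub>units_of R\<^esub> i | i::nat. i \<in> UNIV} = carrier (units_of R)"
    using gen by (simp flip: M add: Multiplicative_Group.nat_pow_mult_of)
  hence "carrier (units_of R) = generate (units_of R) {a}"
    using U.generate_pow_on_finite_carrier[OF fin aU] by simp
  hence "U.ord a = order (units_of R)" using U.generate_pow_card[OF aU] by (simp add: order_def)
  also have "\<dots> = card (carrier R) - 1" using order_mult_of[OF assms] by (simp add: M order_def)
  finally show ?thesis using aU by (auto simp: units_of_carrier)
qed

lemma (in field) card_Units:
  assumes "finite (carrier R)"
  shows "card (Units R) = card (carrier R) - 1" "card (Units R) > 0"
proof -
  have z: "Units R = carrier R - {\<zero>}" by (rule field_Units)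
  thus "card (Units R) = card (carrier R) - 1" using assms by simp
  have "finite (Units R)" "Units R \<noteq> {}" using assms z by auto
  thus "card (Units R) > 0" by (simp add: card_gt_0_iff)
qed

lemma (in field) units_of_iso_cyclic:
  assumes fin: "finite (carrier R)"
  shows "units_of R \<cong> cyclic (card (carrier R) - 1)"
proof -
  interpret U: group "units_of R" by (rule units_group)
  let ?N = "card (carrier R) - 1"
  obtain a where "a \<in> Units R" and ord: "U.ord a = ?N"
    using units_generator[OF assms] by blast
  hence a: "a \<in> carrier (units_of R)" by (simp add: units_of_carrier)
  \<comment> \<open>\<open>card_Units\<close> also gives \<open>?N > 0\<close>, which matters
    because \<open>cyclic 0\<close> is the group of all integers.\<close>
  have cc: "carrier (cyclic ?N) = {0..<int ?N}"
    using card_Units[OF fin] by (simp add: carrier_integer_mod_group)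
  have eq: "a [^]\<^bsub>units_of R\<^esub> i = a [^]\<^bsub>units_of R\<^esub> j \<longleftrightarrow> i mod int ?N = j mod int ?N" for i j :: int
    unfolding U.int_pow_eq[OF a] ord by (metis mod_eq_dvd_iff)
  have "(\<lambda>i::int. a [^]\<^bsub>units_of R\<^esub> i) \<in> iso (cyclic ?N) (units_of R)"
    unfolding iso_iff
  proof (intro conjI)
    show "(\<lambda>i::int. a [^]\<^bsub>units_of R\<^esub> i) \<in> hom (cyclic ?N) (units_of R)"
    proof (rule homI)
      fix i j :: int
      have "a [^]\<^bsub>units_of R\<^esub> ((i + j) mod int ?N) = a [^]\<^bsub>units_of R\<^esub> (i + j)" unfolding eq by simp
      thus "a [^]\<^bsub>units_of R\<^esub> (i \<otimes>\<^bsub>cyclic ?N\<^esub> j) = a [^]\<^bsub>units_of R\<^esub> i \<otimes>\<^bsub>units_of R\<^esub> a [^]\<^bsub>units_of R\<^esub> j"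
        using a by (simp add: U.int_pow_mult)
    qed (rule U.int_pow_closed[OF a])
    show inj: "inj_on (\<lambda>i::int. a [^]\<^bsub>units_of R\<^esub> i) (carrier (cyclic ?N))"
      unfolding cc by (rule inj_onI) (auto simp only: eq atLeastLessThan_iff mod_pos_pos_trivial)
    show "(\<lambda>i::int. a [^]\<^bsub>units_of R\<^esub> i) ` carrier (cyclic ?N) = carrier (units_of R)"
    proof (rule card_subset_eq)
      show "finite (carrier (units_of R))"
        using card_Units(2)[OF fin] by (simp add: units_of_carrier card_gt_0_iff)
      show "(\<lambda>i::int. a [^]\<^bsub>units_of R\<^esub> i) ` carrier (cyclic ?N) \<subseteq> carrier (units_of R)"
        using U.int_pow_closed[OF a] by blast
      show "card ((\<lambda>i::int. a [^]\<^bsub>units_of R\<^esub> i) ` carrier (cyclic ?N)) = card (carrier (units_of R))"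
        unfolding card_image[OF inj] unfolding cc using card_Units(1)[OF fin] by (simp add: units_of_carrier)
    qed
  qed
  hence "cyclic ?N \<cong> units_of R" by (rule is_isoI)
  thus ?thesis by (rule group.iso_sym[OF group_integer_mod_group])
qed

section \<open>Augmentation, linear extensions of characters, and scalars\<close>

context finite_group_algebra
begin

definition "aug f = pairing f (\<lambda>_. \<one>)"

lemma aug_closed: "f \<in> carrier RG \<Longrightarrow> aug f \<in> carrier R"
  unfolding aug_def by (auto intro: pairing_closed)

text \<open>The linear extension of a character is multiplicative. It serves for the trivial
  character, which is the augmentation, and over the quadratic extension for all 32
  characters.\<close>

lemma pairing_mult_hom:
  assumes f: "f \<in> carrier RG" and g: "g \<in> carrier RG" and w: "w \<in> carrier G \<rightarrow> carrier R"
    and hom: "\<And>x y. x \<in> carrier G \<Longrightarrow> y \<in> carrier G \<Longrightarrow> w (x \<otimes>\<^bsub>G\<^esub> y) = w x \<otimes> w y"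
  shows "pairing (f \<otimes>\<^bsub>RG\<^esub> g) w = pairing f w \<otimes> pairing g w"
proof -
  have wc: "x \<in> carrier G \<Longrightarrow> w x \<in> carrier R" for x using w by auto
  note cl = RG_mem[OF f] RG_mem[OF g] wc
  have pc: "pairing g w \<in> carrier R" using pairing_closed[OF g w] .
  have "pairing g (\<lambda>z. w (y \<otimes>\<^bsub>G\<^esub> z)) = w y \<otimes> pairing g w" if y: "y \<in> carrier G" for y
  proof -
    have "pairing g (\<lambda>z. w (y \<otimes>\<^bsub>G\<^esub> z)) = (\<Oplus>x\<in>carrier G. w y \<otimes> (g x \<otimes> w x))"
      unfolding pairing_def using y cl hom by (intro finsum_cong') (auto simp: R.m_lcomm)
    also have "\<dots> = w y \<otimes> pairing g w"
      unfolding pairing_def using y cl finite_G by (intro finsum_rdistr[symmetric]) auto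
    finally show ?thesis .
  qed
  hence "pairing (f \<otimes>\<^bsub>RG\<^esub> g) w = (\<Oplus>y\<in>carrier G. (f y \<otimes> w y) \<otimes> pairing g w)"
    unfolding pairing_mult[OF f g w] using cl pc by (intro finsum_cong') (auto simp: R.m_assoc)
  also have "\<dots> = pairing f w \<otimes> pairing g w"
    unfolding pairing_def[of f] using cl pc finite_G by (intro finsum_ldistr[symmetric]) auto
  finally show ?thesis .
qed

lemma aug_mult:
  "f \<in> carrier RG \<Longrightarrow> g \<in> carrier RG \<Longrightarrow> aug (f \<otimes>\<^bsub>RG\<^esub> g) = aug f \<otimes> aug g"
  unfolding aug_def by (intro pairing_mult_hom) auto

lemma pairing_one: "w \<in> carrier G \<rightarrow> carrier R \<Longrightarrow> pairing \<one>\<^bsub>RG\<^esub> w = w \<one>\<^bsub>G\<^esub>"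
proof -
  assume w: "w \<in> carrier G \<rightarrow> carrier R"
  have "pairing \<one>\<^bsub>RG\<^esub> w = (\<Oplus>x\<in>carrier G. w x \<otimes> (if x = \<one>\<^bsub>G\<^esub> then \<one> else \<zero>))"
    unfolding pairing_def RG_one using w by (intro finsum_cong') (auto simp: Pi_def)
  also have "\<dots> = w \<one>\<^bsub>G\<^esub>" using w finite_G by (intro finsum_indicator) auto
  finally show ?thesis .
qed

lemma aug_one: "aug \<one>\<^bsub>RG\<^esub> = \<one>"
  unfolding aug_def by (subst pairing_one) auto

definition "scale c f = (\<lambda>x\<in>carrier G. c \<otimes> f x)"

lemma scale_closed: "c \<in> carrier R \<Longrightarrow> f \<in> carrier RG \<Longrightarrow> scale c f \<in> carrier RG"
  by (auto simp: scale_def carrier_RG)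

lemma pairing_scale:
  assumes "c \<in> carrier R" "f \<in> carrier RG" "w \<in> carrier G \<rightarrow> carrier R"
  shows "pairing (scale c f) w = c \<otimes> pairing f w"
proof -
  have "pairing (scale c f) w = (\<Oplus>x\<in>carrier G. c \<otimes> (f x \<otimes> w x))"
    unfolding pairing_def scale_def using assms
    by (intro finsum_cong') (auto simp: RG_mem R.m_assoc Pi_def)
  also have "\<dots> = c \<otimes> pairing f w"
    unfolding pairing_def using assms finite_G
    by (intro finsum_rdistr[symmetric]) (auto simp: RG_mem Pi_def)
  finally show ?thesis .
qed

lemma scale_mult_left:
  assumes "c \<in> carrier R" and f: "f \<in> carrier RG" and g: "g \<in> carrier RG"
  shows "scale c f \<otimes>\<^bsub>RG\<^esub> g = scale c (f \<otimes>\<^bsub>RG\<^esub> g)"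
proof (rule RG_eqI)
  fix x assume x: "x \<in> carrier G"
  have "(scale c f \<otimes>\<^bsub>RG\<^esub> g) x = pairing (scale c f) (\<lambda>y. g (inv\<^bsub>G\<^esub> y \<otimes>\<^bsub>G\<^esub> x))"
    using x by (simp add: RG_mult[OF scale_closed[OF assms(1) f] g] pairing_def)
  also have "\<dots> = c \<otimes> pairing f (\<lambda>y. g (inv\<^bsub>G\<^esub> y \<otimes>\<^bsub>G\<^esub> x))"
    using assms x by (intro pairing_scale) (auto simp: RG_mem)
  also have "\<dots> = scale c (f \<otimes>\<^bsub>RG\<^esub> g) x"
    using x by (simp add: RG_mult[OF f g] pairing_def scale_def)
  finally show "(scale c f \<otimes>\<^bsub>RG\<^esub> g) x = scale c (f \<otimes>\<^bsub>RG\<^esub> g) x" .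
qed (use assms in \<open>auto intro!: scale_closed RG_mult_closed\<close>)

lemma scale_scale:
  "c \<in> carrier R \<Longrightarrow> d \<in> carrier R \<Longrightarrow> f \<in> carrier RG \<Longrightarrow> scale c (scale d f) = scale (c \<otimes> d) f"
  by (rule ext) (simp add: scale_def R.m_assoc RG_mem)

lemma scale_mult:
  assumes c: "c \<in> carrier R" and d: "d \<in> carrier R" and f: "f \<in> carrier RG" and g: "g \<in> carrier RG"
  shows "scale c f \<otimes>\<^bsub>RG\<^esub> scale d g = scale (c \<otimes> d) (f \<otimes>\<^bsub>RG\<^esub> g)"
proof -
  have "f \<otimes>\<^bsub>RG\<^esub> scale d g = scale d g \<otimes>\<^bsub>RG\<^esub> f" by (rule RG_mult_comm[OF f scale_closed[OF d g]])
  also have "\<dots> = scale d (g \<otimes>\<^bsub>RG\<^esub> f)" by (rule scale_mult_left[OF d g f])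
  also have "g \<otimes>\<^bsub>RG\<^esub> f = f \<otimes>\<^bsub>RG\<^esub> g" by (rule RG_mult_comm[OF g f])
  finally have "scale c (f \<otimes>\<^bsub>RG\<^esub> scale d g) = scale (c \<otimes> d) (f \<otimes>\<^bsub>RG\<^esub> g)"
    using scale_scale[OF c d RG_mult_closed[OF f g]] by simp
  thus ?thesis using scale_mult_left[OF c f scale_closed[OF d g]] by simp
qed

lemma scale_one: "f \<in> carrier RG \<Longrightarrow> scale \<one> f = f"
  by (rule RG_eqI[OF scale_closed]) (simp_all add: scale_def RG_mem)

text \<open>Invertibility is not part of the definition: in characteristic 2 it is derived by
  \<open>norm_supported_Units\<close>. \<open>S\<close> may be any set, so that squares can be
  described before anything is known to be a subgroup.\<close>

definition "norm_supported S = {f \<in> carrier RG. aug f = \<one> \<and> (\<forall>x\<in>carrier G - S. f x = \<zero>)}"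

end

section \<open>Squaring in characteristic 2\<close>

locale char2_group_algebra = finite_group_algebra R G + F?: field R
  for R (structure) and G (structure) +
  assumes finite_R: "finite (carrier R)" and one_add_one: "\<one> \<oplus> \<one> = \<zero>"
begin

lemma add_self: "x \<in> carrier R \<Longrightarrow> x \<oplus> x = \<zero>"
  by (metis R.l_distr R.l_null R.l_one R.one_closed one_add_one)

text \<open>In characteristic 2 the square of a sum is the sum of the squares; if the latter agree,
  the sum squares to zero and is therefore zero.\<close>

lemma square_inj:
  assumes "x \<in> carrier R" "y \<in> carrier R" "x \<otimes> x = y \<otimes> y"
  shows "x = y"
proof -
  have "(x \<oplus> y) \<otimes> (x \<oplus> y) = (x \<otimes> x \<oplus> y \<otimes> y) \<oplus> (x \<otimes> y \<oplus> x \<otimes> y)"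
    using assms(1,2) by algebra
  also have "\<dots> = \<zero>" using add_self assms by simp
  finally have "x \<oplus> y = \<zero>" using assms F.integral by auto
  moreover have "y \<oplus> y = \<zero>" using add_self assms by auto
  ultimately show ?thesis using assms by (metis R.add.right_cancel)
qed

lemma square_surj:
  assumes "y \<in> carrier R" shows "\<exists>x\<in>carrier R. x \<otimes> x = y"
proof -
  have "inj_on (\<lambda>x. x \<otimes> x) (carrier R)" using square_inj by (auto intro: inj_onI)
  hence "(\<lambda>x. x \<otimes> x) ` carrier R = carrier R" using finite_R by (intro endo_inj_surj) auto
  thus ?thesis using assms by (metis (no_types, lifting) imageE)
qed

text \<open>The double sum is symmetric in its two indices, so only the diagonal survives. This is
  the Frobenius map in tested form.\<close>

lemma pairing_square:
  assumes f: "f \<in> carrier RG" and w: "w \<in> carrier G \<rightarrow> carrier R"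
  shows "pairing (f \<otimes>\<^bsub>RG\<^esub> f) w = (\<Oplus>y\<in>carrier G. f y \<otimes> (f y \<otimes> w (y \<otimes>\<^bsub>G\<^esub> y)))"
proof -
  have wc: "x \<in> carrier G \<Longrightarrow> w x \<in> carrier R" for x using w by auto
  note cl = RG_mem[OF f] wc
  show ?thesis unfolding pairing_mult_double[OF f f w] using finite_G cl add_self
    by (intro finsum_symmetric_diagonal) (auto simp: R.m_lcomm G.m_comm)
qed

text \<open>Squares are supported on squares because only the products of \<open>y\<close> with
  itself survive in \<open>pairing_square\<close>. Conversely, a square root of \<open>f\<close> is
  built by choosing one root in \<open>S\<close> for every square and placing there the root of the
  coefficient of \<open>f\<close>.\<close>

lemma square_image:
  assumes S: "S \<subseteq> carrier G"
  shows "(\<lambda>f. f \<otimes>\<^bsub>RG\<^esub> f) ` norm_supported S = norm_supported ((\<lambda>x. x \<otimes>\<^bsub>G\<^esub> x) ` S)"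
proof (intro equalityI subsetI)
  fix g assume "g \<in> (\<lambda>f. f \<otimes>\<^bsub>RG\<^esub> f) ` norm_supported S"
  then obtain f where f: "f \<in> carrier RG" "aug f = \<one>" "\<And>x. x \<in> carrier G - S \<Longrightarrow> f x = \<zero>"
    and g: "g = f \<otimes>\<^bsub>RG\<^esub> f" by (auto simp: norm_supported_def)
  have gc: "g \<in> carrier RG" using g f RG_mult_closed by auto
  have "g x = \<zero>" if x: "x \<in> carrier G" "x \<notin> (\<lambda>x. x \<otimes>\<^bsub>G\<^esub> x) ` S" for x
  proof -
    have "g x = pairing g (delta x)" using gc x by (simp add: pairing_delta)
    also have "\<dots> = (\<Oplus>y\<in>carrier G. f y \<otimes> (f y \<otimes> delta x (y \<otimes>\<^bsub>G\<^esub> y)))"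
      unfolding g by (rule pairing_square[OF f(1) delta_fun])
    also have "\<dots> = \<zero>"
    proof (rule R.add.finprod_one_eqI)
      fix y assume y: "y \<in> carrier G"
      show "f y \<otimes> (f y \<otimes> delta x (y \<otimes>\<^bsub>G\<^esub> y)) = \<zero>"
      proof (cases "y \<in> S")
        case True
        hence "y \<otimes>\<^bsub>G\<^esub> y \<noteq> x" using x by auto
        thus ?thesis using y f RG_mem by (auto simp: delta_def)
      next
        case False
        thus ?thesis using y f RG_mem by (auto simp: delta_def)
      qed
    qed
    finally show ?thesis .
  qed
  moreover have "aug g = \<one>" using f g aug_mult by simp
  ultimately show "g \<in> norm_supported ((\<lambda>x. x \<otimes>\<^bsub>G\<^esub> x) ` S)" using gc by (auto simp: norm_supported_def)
next
  fix f assume "f \<in> norm_supported ((\<lambda>x. x \<otimes>\<^bsub>G\<^esub> x) ` S)"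
  hence f: "f \<in> carrier RG" "aug f = \<one>" "\<And>x. x \<in> carrier G \<Longrightarrow> x \<notin> (\<lambda>x. x \<otimes>\<^bsub>G\<^esub> x) ` S \<Longrightarrow> f x = \<zero>"
    by (auto simp: norm_supported_def)
  define \<sigma> where "\<sigma> x = (SOME y. y \<in> S \<and> x = y \<otimes>\<^bsub>G\<^esub> y)" for x
  have \<sigma>: "\<sigma> x \<in> S \<and> x = \<sigma> x \<otimes>\<^bsub>G\<^esub> \<sigma> x" if "x \<in> (\<lambda>x. x \<otimes>\<^bsub>G\<^esub> x) ` S" for x
    unfolding \<sigma>_def by (rule someI_ex) (use that in auto)
  hence \<sigma>sq: "\<sigma> (y \<otimes>\<^bsub>G\<^esub> y) \<otimes>\<^bsub>G\<^esub> \<sigma> (y \<otimes>\<^bsub>G\<^esub> y) = y \<otimes>\<^bsub>G\<^esub> y" if "y \<in> S" for y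
    using that by auto
  obtain r where r: "\<And>a. a \<in> carrier R \<Longrightarrow> r a \<in> carrier R \<and> r a \<otimes> r a = a"
    using square_surj by metis
  \<comment> \<open>\<open>P\<close> contains exactly one root of each square; the other elements of
    \<open>S\<close> get coefficient zero, so that no two roots of the same square
    contribute.\<close>
  define P where "P = \<sigma> ` ((\<lambda>x. x \<otimes>\<^bsub>G\<^esub> x) ` S)"
  have PS: "P \<subseteq> S" using \<sigma> by (auto simp: P_def)
  have inj: "inj_on \<sigma> ((\<lambda>x. x \<otimes>\<^bsub>G\<^esub> x) ` S)"
  proof (rule inj_onI)
    fix x y assume xy: "x \<in> (\<lambda>x. x \<otimes>\<^bsub>G\<^esub> x) ` S" "y \<in> (\<lambda>x. x \<otimes>\<^bsub>G\<^esub> x) ` S" "\<sigma> x = \<sigma> y"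
    have "x = \<sigma> x \<otimes>\<^bsub>G\<^esub> \<sigma> x" "y = \<sigma> y \<otimes>\<^bsub>G\<^esub> \<sigma> y" using \<sigma> xy by blast+
    thus "x = y" using xy(3) by simp
  qed
  define h where "h = (\<lambda>y\<in>carrier G. if y \<in> P then r (f (y \<otimes>\<^bsub>G\<^esub> y)) else \<zero>)"
  have hc: "h \<in> carrier RG" using r f RG_mem by (auto simp: h_def carrier_RG)
  have hs: "\<forall>x\<in>carrier G - S. h x = \<zero>" using PS by (auto simp: h_def)
  have hh: "h \<otimes>\<^bsub>RG\<^esub> h = f"
  proof (rule RG_eqI_pairing[OF RG_mult_closed[OF hc hc] f(1)])
    fix w assume w: "w \<in> carrier G \<rightarrow> carrier R"
    have wc: "x \<in> carrier G \<Longrightarrow> w x \<in> carrier R" for x using w by auto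
    note cl = RG_mem[OF f(1)] RG_mem[OF hc] wc
    have "pairing (h \<otimes>\<^bsub>RG\<^esub> h) w = (\<Oplus>y\<in>carrier G. h y \<otimes> (h y \<otimes> w (y \<otimes>\<^bsub>G\<^esub> y)))"
      by (rule pairing_square[OF hc w])
    also have "\<dots> = (\<Oplus>y\<in>P. f (y \<otimes>\<^bsub>G\<^esub> y) \<otimes> w (y \<otimes>\<^bsub>G\<^esub> y))"
    proof (rule R.add.finprod_mono_neutral_cong_right)
      show "finite (carrier G)" "P \<subseteq> carrier G" using finite_G PS S by auto
      fix y assume y: "y \<in> P"
      hence yG: "y \<in> carrier G" using PS S by auto
      have rc: "r (f (y \<otimes>\<^bsub>G\<^esub> y)) \<in> carrier R" "r (f (y \<otimes>\<^bsub>G\<^esub> y)) \<otimes> r (f (y \<otimes>\<^bsub>G\<^esub> y)) = f (y \<otimes>\<^bsub>G\<^esub> y)"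
        using r cl yG by auto
      have "h y \<otimes> (h y \<otimes> w (y \<otimes>\<^bsub>G\<^esub> y)) = (h y \<otimes> h y) \<otimes> w (y \<otimes>\<^bsub>G\<^esub> y)"
        using cl yG by (simp add: R.m_assoc)
      also have "h y \<otimes> h y = f (y \<otimes>\<^bsub>G\<^esub> y)" using y yG rc by (simp add: h_def)
      finally show "h y \<otimes> (h y \<otimes> w (y \<otimes>\<^bsub>G\<^esub> y)) = f (y \<otimes>\<^bsub>G\<^esub> y) \<otimes> w (y \<otimes>\<^bsub>G\<^esub> y)" .
    qed (use cl in \<open>auto simp: h_def\<close>)
    also have "\<dots> = (\<Oplus>x\<in>(\<lambda>x. x \<otimes>\<^bsub>G\<^esub> x) ` S. f (\<sigma> x \<otimes>\<^bsub>G\<^esub> \<sigma> x) \<otimes> w (\<sigma> x \<otimes>\<^bsub>G\<^esub> \<sigma> x))"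
    proof -
      have "\<And>y. y \<in> P \<Longrightarrow> y \<in> carrier G" using PS S by auto
      hence "\<And>y. y \<in> P \<Longrightarrow> f (y \<otimes>\<^bsub>G\<^esub> y) \<otimes> w (y \<otimes>\<^bsub>G\<^esub> y) \<in> carrier R" using cl by auto
      thus ?thesis unfolding P_def
        by (intro finsum_reindex[OF _ inj]) (auto simp: Pi_def)
    qed
    also have "\<dots> = pairing f w"
      unfolding pairing_def
    proof (rule R.add.finprod_mono_neutral_cong_left)
      show "finite (carrier G)" "(\<lambda>x. x \<otimes>\<^bsub>G\<^esub> x) ` S \<subseteq> carrier G" using finite_G S by auto
    qed (use cl f(3) \<sigma>sq in auto)
    finally show "pairing (h \<otimes>\<^bsub>RG\<^esub> h) w = pairing f w" .
  qed
  \<comment> \<open>The augmentation of \<open>h\<close> squares to 1, so it is 1 because squaring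
    is injective on the field.\<close>
  have "aug f = aug h \<otimes> aug h" using aug_mult[OF hc hc] unfolding hh .
  moreover have "\<one> \<otimes> \<one> = \<one>" by simp
  ultimately have "aug h \<otimes> aug h = \<one> \<otimes> \<one>" unfolding f(2) by metis
  hence "aug h = \<one>" using square_inj aug_closed hc by blast
  hence "h \<in> norm_supported S" using hc hs by (auto simp: norm_supported_def)
  thus "f \<in> (\<lambda>f. f \<otimes>\<^bsub>RG\<^esub> f) ` norm_supported S" using hh by auto
qed

end

context finite_group_algebra begin

text \<open>The coefficients off the identity are free and the one at the identity is then forced by
  augmentation 1; hence the exponent \<open>card S - 1\<close>.\<close>

lemma card_norm_supported:
  assumes S: "S \<subseteq> carrier G" and one: "\<one>\<^bsub>G\<^esub> \<in> S"
  shows "card (norm_supported S) = card (carrier R) ^ (card S - 1)"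
proof -
  let ?S = "S - {\<one>\<^bsub>G\<^esub>}"
  have finS: "finite S" using S finite_G finite_subset by blast
  have aug_S: "aug f = f \<one>\<^bsub>G\<^esub> \<oplus> (\<Oplus>x\<in>?S. f x)"
    if f: "f \<in> carrier RG" "\<And>x. x \<in> carrier G - S \<Longrightarrow> f x = \<zero>" for f
  proof -
    have "aug f = (\<Oplus>x\<in>S. f x)" unfolding aug_def pairing_def
      using f S finite_G by (intro R.add.finprod_mono_neutral_cong_right) (auto simp: RG_mem Pi_def)
    also have "S = insert \<one>\<^bsub>G\<^esub> ?S" using one by auto
    also have "(\<Oplus>x\<in>insert \<one>\<^bsub>G\<^esub> ?S. f x) = f \<one>\<^bsub>G\<^esub> \<oplus> (\<Oplus>x\<in>?S. f x)"
      using finS f S by (intro finsum_insert) (auto simp: RG_mem Pi_def)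
    finally show ?thesis .
  qed
  have "bij_betw (\<lambda>f. restrict f ?S) (norm_supported S) (?S \<rightarrow>\<^sub>E carrier R)"
    unfolding bij_betw_def
  proof (intro conjI equalityI subsetI)
    show "inj_on (\<lambda>f. restrict f ?S) (norm_supported S)"
    proof (rule inj_onI)
      fix f g assume fg: "f \<in> norm_supported S" "g \<in> norm_supported S" and e: "restrict f ?S = restrict g ?S"
      have e': "f x = g x" if "x \<in> ?S" for x using e that by (metis restrict_apply')
      have fgc: "f \<in> carrier RG" "g \<in> carrier RG" using fg by (auto simp: norm_supported_def)
      have sums: "(\<Oplus>x\<in>?S. f x) = (\<Oplus>x\<in>?S. g x)" using e' fgc S by (intro finsum_cong') (auto simp: RG_mem)
      have sc: "(\<Oplus>x\<in>?S. g x) \<in> carrier R" using fgc S by (intro finsum_closed) (auto simp: RG_mem)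
      have "f \<one>\<^bsub>G\<^esub> \<oplus> (\<Oplus>x\<in>?S. g x) = g \<one>\<^bsub>G\<^esub> \<oplus> (\<Oplus>x\<in>?S. g x)"
        using fg aug_S[of f] aug_S[of g] sums by (auto simp: norm_supported_def)
      hence one_eq: "f \<one>\<^bsub>G\<^esub> = g \<one>\<^bsub>G\<^esub>" using sc fgc by (simp add: RG_mem)
      show "f = g"
      proof (rule RG_eqI[OF fgc])
        fix x assume "x \<in> carrier G"
        thus "f x = g x" using e'[of x] one_eq fg by (cases "x \<in> S"; cases "x = \<one>\<^bsub>G\<^esub>") (auto simp: norm_supported_def)
      qed
    qed
  next
    fix g assume "g \<in> (\<lambda>f. restrict f ?S) ` norm_supported S"
    then obtain f where f: "f \<in> carrier RG" "g = restrict f ?S" by (auto simp: norm_supported_def)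
    have "f \<in> ?S \<rightarrow> carrier R" using f S by (auto simp: RG_mem)
    thus "g \<in> ?S \<rightarrow>\<^sub>E carrier R" unfolding f(2) by (simp add: restrict_PiE_iff Pi_iff)
  next
    fix g assume g: "g \<in> ?S \<rightarrow>\<^sub>E carrier R"
    hence gc: "x \<in> ?S \<Longrightarrow> g x \<in> carrier R" for x by auto
    have sc: "(\<Oplus>x\<in>?S. g x) \<in> carrier R" using gc by (intro finsum_closed) auto
    define f where "f = (\<lambda>x\<in>carrier G. if x \<in> ?S then g x else if x = \<one>\<^bsub>G\<^esub> then \<one> \<ominus> (\<Oplus>x\<in>?S. g x) else \<zero>)"
    have fc: "f \<in> carrier RG" using gc sc by (auto simp: f_def carrier_RG)
    have f1: "f \<one>\<^bsub>G\<^esub> = \<one> \<ominus> (\<Oplus>x\<in>?S. g x)" by (simp add: f_def)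
    have f0: "x \<in> carrier G - S \<Longrightarrow> f x = \<zero>" for x using one by (auto simp: f_def)
    have "restrict f ?S x = g x" for x
      using PiE_arb[OF g, of x] S by (cases "x \<in> ?S") (auto simp: f_def)
    hence fr: "restrict f ?S = g" by (rule ext)
    have "(\<Oplus>x\<in>?S. f x) = (\<Oplus>x\<in>?S. g x)" using S gc by (intro finsum_cong') (auto simp: f_def)
    hence "aug f = (\<one> \<ominus> (\<Oplus>x\<in>?S. g x)) \<oplus> (\<Oplus>x\<in>?S. g x)" using aug_S[OF fc f0] f1 by simp
    also have "\<dots> = \<one>" using sc by (simp add: R.minus_eq R.a_assoc R.l_neg)
    finally have "f \<in> norm_supported S" using fc f0 by (auto simp: norm_supported_def)
    thus "g \<in> (\<lambda>f. restrict f ?S) ` norm_supported S" using fr by auto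
  qed
  hence "card (norm_supported S) = card (?S \<rightarrow>\<^sub>E carrier R)" by (rule bij_betw_same_card)
  also have "\<dots> = card (carrier R) ^ card ?S" using finS by (simp add: card_funcsetE)
  finally show ?thesis using one finS by simp
qed

end

section \<open>Units in characteristic 2\<close>

lemma DirProd_assoc: "(A \<times>\<times> B) \<times>\<times> C \<cong> A \<times>\<times> (B \<times>\<times> C)"
proof (rule is_isoI)
  show "(\<lambda>((x, y), z). (x, y, z)) \<in> iso ((A \<times>\<times> B) \<times>\<times> C) (A \<times>\<times> (B \<times>\<times> C))"
    unfolding iso_iff
  proof (intro conjI)
    show "(\<lambda>((x, y), z). (x, y, z)) ` carrier ((A \<times>\<times> B) \<times>\<times> C) = carrier (A \<times>\<times> (B \<times>\<times> C))"
      by force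
  qed (auto intro!: homI inj_onI)
qed

text \<open>Cuts the list of cyclic factors, sorted by orders 8, 4, 2, into blocks of constant
  order.\<close>

lemma product_group_split:
  fixes a b :: nat
  shows "product_group {..<a + b} H \<cong> product_group {..<a} H \<times>\<times> product_group {..<b} (\<lambda>i. H (a + i))"
  (is "?P \<cong> ?A \<times>\<times> ?B")
proof (rule is_isoI)
  let ?f = "\<lambda>t. (restrict t {..<a}, \<lambda>i\<in>{..<b}. t (a + i))"
  have closed: "?f t \<in> carrier (?A \<times>\<times> ?B)" if t: "t \<in> carrier ?P" for t
  proof -
    have "t i \<in> carrier (H i)" if "i < a + b" for i using t that PiE_mem[of t "{..<a + b}" _ i] by simp
    thus ?thesis by (simp add: restrict_PiE_iff)
  qed
  show "?f \<in> iso ?P (?A \<times>\<times> ?B)"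
    unfolding iso_iff
  proof (intro conjI)
    show "?f \<in> hom ?P (?A \<times>\<times> ?B)"
    proof (rule homI)
      fix t s
      show "?f (t \<otimes>\<^bsub>?P\<^esub> s) = ?f t \<otimes>\<^bsub>?A \<times>\<times> ?B\<^esub> ?f s"
        by (auto simp: restrict_def)
    qed (rule closed)
    show "inj_on ?f (carrier ?P)"
    proof (rule inj_onI)
      fix t s assume ts: "t \<in> carrier ?P" "s \<in> carrier ?P" and e: "?f t = ?f s"
      have r1: "restrict t {..<a} = restrict s {..<a}"
        and r2: "(\<lambda>i\<in>{..<b}. t (a + i)) = (\<lambda>i\<in>{..<b}. s (a + i))"
        using e by simp_all
      have e1: "t i = s i" if "i < a" for i
        using fun_cong[OF r1, of i] that by simp
      have e2: "t (a + i) = s (a + i)" if "i < b" for i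
        using fun_cong[OF r2, of i] that by simp
      show "t = s"
      proof (rule PiE_ext)
        show "t \<in> (\<Pi>\<^sub>E i\<in>{..<a + b}. carrier (H i))" "s \<in> (\<Pi>\<^sub>E i\<in>{..<a + b}. carrier (H i))"
          using ts by simp_all
        fix i assume i: "i \<in> {..<a + b}"
        show "t i = s i"
          using e1[of i] e2[of "i - a"] i by (cases "i < a") simp_all
      qed
    qed
    show "?f ` carrier ?P = carrier (?A \<times>\<times> ?B)"
    proof (intro equalityI subsetI)
      fix y assume "y \<in> carrier (?A \<times>\<times> ?B)"
      then obtain u v where y: "y = (u, v)" and u: "u \<in> (\<Pi>\<^sub>E i\<in>{..<a}. carrier (H i))"
        and v: "v \<in> (\<Pi>\<^sub>E i\<in>{..<b}. carrier (H (a + i)))" by (cases y) simp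
      define t where "t = (\<lambda>i\<in>{..<a + b}. if i < a then u i else v (i - a))"
      have "v (i - a) \<in> carrier (H i)" if "\<not> i < a" "i < a + b" for i
        using PiE_mem[OF v, of "i - a"] that by simp
      moreover have "u i \<in> carrier (H i)" if "i < a" for i using PiE_mem[OF u, of i] that by simp
      ultimately have t: "t \<in> carrier ?P" unfolding t_def by (simp add: restrict_PiE_iff)
      have tu: "restrict t {..<a} i = u i" for i
        using PiE_arb[OF u, of i] by (cases "i < a") (simp_all add: t_def)
      have tv: "(\<lambda>i\<in>{..<b}. t (a + i)) i = v i" for i
        using PiE_arb[OF v, of i] by (cases "i < b") (simp_all add: t_def)
      have "y = ?f t" unfolding y ext[OF tu] ext[OF tv] ..
      thus "y \<in> ?f ` carrier ?P" using t by (rule image_eqI)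
    next
      fix y assume "y \<in> ?f ` carrier ?P"
      thus "y \<in> carrier (?A \<times>\<times> ?B)" using closed by (elim imageE) (simp only:)
    qed
  qed
qed

section \<open>Normalized units as a group, and the scalar factor\<close>

context finite_group_algebra
begin

text \<open>The only possibly nonzero coefficient equals the augmentation. This trivial set is where
  repeated squaring ends.\<close>

lemma norm_supported_singleton: "norm_supported {\<one>\<^bsub>G\<^esub>} = {\<one>\<^bsub>RG\<^esub>}"
proof -
  have "f = \<one>\<^bsub>RG\<^esub>" if f: "f \<in> norm_supported {\<one>\<^bsub>G\<^esub>}" for f
  proof -
    have fc: "f \<in> carrier RG" and f0: "\<And>x. x \<in> carrier G \<Longrightarrow> x \<noteq> \<one>\<^bsub>G\<^esub> \<Longrightarrow> f x = \<zero>" and a: "aug f = \<one>"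
      using f by (auto simp: norm_supported_def)
    have "aug f = (\<Oplus>x\<in>carrier G. f \<one>\<^bsub>G\<^esub> \<otimes> (if x = \<one>\<^bsub>G\<^esub> then \<one> else \<zero>))"
      unfolding aug_def pairing_def using f0 fc by (intro finsum_cong') (auto simp: RG_mem)
    also have "\<dots> = f \<one>\<^bsub>G\<^esub>" using finite_G fc by (intro finsum_indicator) (auto simp: RG_mem)
    finally have "f \<one>\<^bsub>G\<^esub> = \<one>" using a by simp
    thus ?thesis using f0 fc by (intro RG_eqI RG_one_closed) (auto simp: RG_one)
  qed
  moreover have "\<one>\<^bsub>RG\<^esub> \<in> norm_supported {\<one>\<^bsub>G\<^esub>}"
    using RG_one_closed aug_one by (auto simp: norm_supported_def RG_one)
  ultimately show ?thesis by blast
qed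

lemma finite_norm_supported: "finite (carrier R) \<Longrightarrow> finite (norm_supported S)"
  by (rule finite_subset[of _ "carrier RG"])
     (auto simp: norm_supported_def carrier_RG finite_G intro!: finite_PiE)

lemma Units_square:
  assumes f: "f \<in> carrier RG" and "f \<otimes>\<^bsub>RG\<^esub> f \<in> Units RG"
  shows "f \<in> Units RG"
proof -
  interpret M: comm_monoid RG by (rule RG_comm_monoid)
  show ?thesis using M.unit_factor[OF assms(2) f f] .
qed

lemma norm_supported_mult:
  assumes S: "subgroup S G" and f: "f \<in> norm_supported S" and g: "g \<in> norm_supported S"
  shows "f \<otimes>\<^bsub>RG\<^esub> g \<in> norm_supported S"
proof -
  have fg: "f \<in> carrier RG" "g \<in> carrier RG" using f g by (auto simp: norm_supported_def)
  have "(f \<otimes>\<^bsub>RG\<^esub> g) x = \<zero>" if x: "x \<in> carrier G" "x \<notin> S" for x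
  proof -
    have "(\<Oplus>y\<in>carrier G. f y \<otimes> g (inv\<^bsub>G\<^esub> y \<otimes>\<^bsub>G\<^esub> x)) = \<zero>"
    proof (rule R.add.finprod_one_eqI)
      fix y assume y: "y \<in> carrier G"
      show "f y \<otimes> g (inv\<^bsub>G\<^esub> y \<otimes>\<^bsub>G\<^esub> x) = \<zero>"
      proof (cases "y \<in> S")
        case True
        have "inv\<^bsub>G\<^esub> y \<otimes>\<^bsub>G\<^esub> x \<notin> S"
        proof
          assume "inv\<^bsub>G\<^esub> y \<otimes>\<^bsub>G\<^esub> x \<in> S"
          hence "y \<otimes>\<^bsub>G\<^esub> (inv\<^bsub>G\<^esub> y \<otimes>\<^bsub>G\<^esub> x) \<in> S" using True S by (simp add: subgroup.m_closed)
          thus False using x y by (simp add: G.m_assoc[symmetric])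
        qed
        thus ?thesis using x y g fg by (auto simp: norm_supported_def RG_mem)
      next
        case False
        thus ?thesis using x y f fg by (auto simp: norm_supported_def RG_mem)
      qed
    qed
    thus ?thesis using x by (simp add: RG_mult[OF fg])
  qed
  thus ?thesis using f g by (auto simp: norm_supported_def RG_mult_closed aug_mult)
qed

text \<open>Closure under inverses comes from finiteness: multiplication by \<open>f\<close> is an
  injective map of the finite set into itself, hence surjective, and so it reaches the
  identity.\<close>

lemma norm_supported_subgroup:
  assumes S: "subgroup S G" and fin: "finite (carrier R)" and U: "norm_supported S \<subseteq> Units RG"
  shows "subgroup (norm_supported S) (units_of RG)"
proof -
  interpret M: comm_monoid RG by (rule RG_comm_monoid)
  interpret U: comm_group "units_of RG" by (rule M.units_comm_group)
  have one: "\<one>\<^bsub>RG\<^esub> \<in> norm_supported S"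
    using subgroup.one_closed[OF S] RG_one_closed aug_one by (auto simp: norm_supported_def RG_one)
  show ?thesis
  proof
    show "norm_supported S \<subseteq> carrier (units_of RG)" using U by (simp add: units_of_carrier)
    show "\<one>\<^bsub>units_of RG\<^esub> \<in> norm_supported S" using one by (simp add: units_of_one)
    fix f assume f: "f \<in> norm_supported S"
    show "f \<otimes>\<^bsub>units_of RG\<^esub> g \<in> norm_supported S" if "g \<in> norm_supported S" for g
      using norm_supported_mult[OF S f that] by (simp add: units_of_mult)
    have fU: "f \<in> Units RG" using f U by auto
    have "inj_on (\<lambda>g. f \<otimes>\<^bsub>RG\<^esub> g) (norm_supported S)"
      using fU by (intro inj_onI) (auto simp: norm_supported_def)
    hence "(\<lambda>g. f \<otimes>\<^bsub>RG\<^esub> g) ` norm_supported S = norm_supported S"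
      using norm_supported_mult[OF S f] finite_norm_supported[OF fin] by (intro endo_inj_surj) auto
    then obtain g where g: "g \<in> norm_supported S" "f \<otimes>\<^bsub>RG\<^esub> g = \<one>\<^bsub>RG\<^esub>" using one by (metis (no_types, lifting) imageE)
    have fgc: "f \<in> carrier RG" "g \<in> carrier RG" using f g by (auto simp: norm_supported_def)
    have "g \<otimes>\<^bsub>units_of RG\<^esub> f = \<one>\<^bsub>units_of RG\<^esub>"
      using g(2) RG_mult_comm[OF fgc] by (simp add: units_of_mult units_of_one)
    hence "inv\<^bsub>units_of RG\<^esub> f = g" using fU g U by (intro U.inv_equality) (auto simp: units_of_carrier)
    thus "inv\<^bsub>units_of RG\<^esub> f \<in> norm_supported S" using g by simp
  qed
qed

lemma scale_Units:
  assumes "v \<in> Units RG" "c \<in> Units R"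
  shows "scale c v \<in> Units RG"
proof -
  interpret M: comm_monoid RG by (rule RG_comm_monoid)
  have c: "c \<in> carrier R" "inv c \<in> carrier R" "c \<otimes> inv c = \<one>" using assms by auto
  have v: "v \<in> carrier RG" "inv\<^bsub>RG\<^esub> v \<in> carrier RG" "v \<otimes>\<^bsub>RG\<^esub> inv\<^bsub>RG\<^esub> v = \<one>\<^bsub>RG\<^esub>" using assms by auto
  have e: "scale c v \<otimes>\<^bsub>RG\<^esub> scale (inv c) (inv\<^bsub>RG\<^esub> v) = \<one>\<^bsub>RG\<^esub>"
    using scale_mult[OF c(1,2) v(1,2)] c(3) v(3) scale_one[OF RG_one_closed] by simp
  have cl: "scale c v \<in> carrier RG" "scale (inv c) (inv\<^bsub>RG\<^esub> v) \<in> carrier RG" using c v scale_closed by auto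
  show ?thesis using M.unit_factor[OF _ cl] e by simp
qed

lemma aug_scale: "c \<in> carrier R \<Longrightarrow> v \<in> carrier RG \<Longrightarrow> aug (scale c v) = c \<otimes> aug v"
  unfolding aug_def by (intro pairing_scale) auto

lemma aug_Units:
  assumes "u \<in> Units RG" shows "aug u \<in> Units R"
proof -
  interpret M: comm_monoid RG by (rule RG_comm_monoid)
  have uc: "u \<in> carrier RG" "inv\<^bsub>RG\<^esub> u \<in> carrier RG" "u \<otimes>\<^bsub>RG\<^esub> inv\<^bsub>RG\<^esub> u = \<one>\<^bsub>RG\<^esub>" using assms by auto
  have "aug u \<otimes> aug (inv\<^bsub>RG\<^esub> u) = \<one>" using aug_mult[OF uc(1,2)] uc(3) aug_one by simp
  thus ?thesis using R.unit_factor[OF _ aug_closed[OF uc(1)] aug_closed[OF uc(2)]] by simp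
qed

text \<open>A unit is its augmentation times a normalized unit, and \<open>aug\<close> recovers the
  scalar, so the decomposition is unique.\<close>

lemma units_of_RG_iso:
  assumes U: "norm_supported (carrier G) \<subseteq> Units RG"
  shows "units_of RG\<lparr>carrier := norm_supported (carrier G)\<rparr> \<times>\<times> units_of R \<cong> units_of RG"
proof (rule is_isoI)
  let ?V = "norm_supported (carrier G)"
  let ?D = "units_of RG\<lparr>carrier := ?V\<rparr> \<times>\<times> units_of R"
  let ?f = "\<lambda>(v, c). scale c v"
  have Vc: "v \<in> carrier RG \<and> aug v = \<one>" if "v \<in> ?V" for v using that by (auto simp: norm_supported_def)
  have cD: "carrier ?D = ?V \<times> Units R" by (simp add: units_of_carrier)
  show "?f \<in> iso ?D (units_of RG)"
    unfolding iso_iff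
  proof (intro conjI)
    show "?f \<in> hom ?D (units_of RG)"
    proof (rule homI)
      show "?f x \<in> carrier (units_of RG)" if "x \<in> carrier ?D" for x
        using that U scale_Units unfolding cD by (auto simp: units_of_carrier)
      fix x y assume "x \<in> carrier ?D" "y \<in> carrier ?D"
      then obtain v c w d where xy: "x = (v, c)" "y = (w, d)"
        and h: "v \<in> carrier RG" "w \<in> carrier RG" "c \<in> carrier R" "d \<in> carrier R"
        unfolding cD using Vc by blast
      show "?f (x \<otimes>\<^bsub>?D\<^esub> y) = ?f x \<otimes>\<^bsub>units_of RG\<^esub> ?f y"
        unfolding xy using scale_mult[OF h(3,4,1,2)] by (simp add: units_of_mult)
    qed
    show "inj_on ?f (carrier ?D)"
    proof (rule inj_onI)
      fix x y assume xyD: "x \<in> carrier ?D" "y \<in> carrier ?D" and e: "?f x = ?f y"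
      then obtain v c w d where xy: "x = (v, c)" "y = (w, d)"
        and h: "v \<in> ?V" "w \<in> ?V" "c \<in> Units R" "d \<in> Units R" unfolding cD by blast
      have s: "scale c v = scale d w" using e xy by simp
      have cl: "c \<in> carrier R" "d \<in> carrier R" "v \<in> carrier RG" "w \<in> carrier RG" using h Vc by auto
      have "aug (scale c v) = c" "aug (scale d w) = d" using aug_scale h cl Vc by auto
      hence cd: "c = d" using s by simp
      have "v = w"
      proof (rule RG_eqI[OF cl(3,4)])
        fix z assume z: "z \<in> carrier G"
        have "scale c v z = scale d w z" using s by simp
        hence "c \<otimes> v z = c \<otimes> w z" using z cd by (simp add: scale_def)
        thus "v z = w z" using h(3) z cl RG_mem by simp
      qed
      thus "x = y" using cd xy by simp
    qed
    show "?f ` carrier ?D = carrier (units_of RG)"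
    proof (intro equalityI subsetI)
      fix u assume "u \<in> ?f ` carrier ?D"
      thus "u \<in> carrier (units_of RG)" using U scale_Units unfolding cD by (auto simp: units_of_carrier)
    next
      interpret M: comm_monoid RG by (rule RG_comm_monoid)
      fix u assume "u \<in> carrier (units_of RG)"
      hence u: "u \<in> Units RG" by (simp add: units_of_carrier)
      hence uc: "u \<in> carrier RG" by auto
      have cU: "aug u \<in> Units R" using aug_Units[OF u] .
      hence c: "aug u \<in> carrier R" "inv (aug u) \<in> carrier R"
        "inv (aug u) \<otimes> aug u = \<one>" "aug u \<otimes> inv (aug u) = \<one>" by auto
      let ?v = "scale (inv (aug u)) u"
      have "?v \<in> ?V" using c uc scale_closed aug_scale by (auto simp: norm_supported_def)
      moreover have "u = scale (aug u) ?v"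
        using scale_scale[OF c(1,2) uc] c(4) scale_one[OF uc] by simp
      ultimately show "u \<in> ?f ` carrier ?D" unfolding cD using cU
        by (intro image_eqI[of _ _ "(?v, aug u)"]) auto
    qed
  qed
qed

end

section \<open>The unit group in characteristic 2\<close>

context char2_group_algebra
begin

text \<open>An element with invertible square is invertible, so invertibility climbs from the
  trivial set back up the chain of squares.\<close>

lemma norm_supported_Units:
  assumes "S \<subseteq> carrier G" and "norm_supported ((\<lambda>x. x \<otimes>\<^bsub>G\<^esub> x) ` S) \<subseteq> Units RG"
  shows "norm_supported S \<subseteq> Units RG"
proof
  fix f assume f: "f \<in> norm_supported S"
  hence "f \<otimes>\<^bsub>RG\<^esub> f \<in> norm_supported ((\<lambda>x. x \<otimes>\<^bsub>G\<^esub> x) ` S)" using square_image[OF assms(1)] by blast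
  thus "f \<in> Units RG" using assms(2) f Units_square by (auto simp: norm_supported_def)
qed

text \<open>The normalized units over \<open>G2\<close>, \<open>G1\<close> and the whole group
  number \<open>q\<close>, \<open>q ^ 3\<close> and \<open>q ^ 31\<close> for
  \<open>q = 2 ^ n\<close>, and each of these groups consists of the squares of the next. Lifting
  gives n generators of order 2 over \<open>G2\<close>; then n of order 4 and 3n - 2n = n of order 2
  over \<open>G1\<close>; finally n of order 8, n of order 4 and 31n - 3n - 2n = 26n of order
  2.\<close>

lemma units_of_RG_C8_C4_C2:
  assumes q: "card (carrier R) = 2 ^ n"
    and G1: "(\<lambda>x. x \<otimes>\<^bsub>G\<^esub> x) ` carrier G = G1" and G2: "(\<lambda>x. x \<otimes>\<^bsub>G\<^esub> x) ` G1 = G2"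
    and G3: "(\<lambda>x. x \<otimes>\<^bsub>G\<^esub> x) ` G2 = {\<one>\<^bsub>G\<^esub>}"
    and sub: "subgroup G1 G" "subgroup G2 G"
    and card: "card (carrier G) = 32" "card G1 = 4" "card G2 = 2"
  shows "units_of RG \<cong> cyclic_power 8 n \<times>\<times> cyclic_power 4 n \<times>\<times> cyclic_power 2 (26 * n) \<times>\<times> cyclic (2 ^ n - 1)"
proof -
  interpret M: comm_monoid RG by (rule RG_comm_monoid)
  interpret U: comm_group "units_of RG" by (rule M.units_comm_group)
  let ?V = norm_supported
  note sq = units_of_mult
  have c1: "G1 \<subseteq> carrier G" and c2: "G2 \<subseteq> carrier G" using sub by (auto simp: subgroup.subset)
  have one: "\<one>\<^bsub>G\<^esub> \<in> G1" "\<one>\<^bsub>G\<^esub> \<in> G2" using sub by (auto simp: subgroup.one_closed)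
  have "?V {\<one>\<^bsub>G\<^esub>} \<subseteq> Units RG" unfolding norm_supported_singleton by simp
  hence u2: "?V G2 \<subseteq> Units RG" using norm_supported_Units[OF c2] unfolding G3 by blast
  hence u1: "?V G1 \<subseteq> Units RG" using norm_supported_Units[OF c1] unfolding G2 by blast
  hence u0: "?V (carrier G) \<subseteq> Units RG" using norm_supported_Units[OF subset_refl] unfolding G1 by blast
  have sg2: "subgroup (?V G2) (units_of RG)" using norm_supported_subgroup[OF sub(2) finite_R u2] .
  have sg1: "subgroup (?V G1) (units_of RG)" using norm_supported_subgroup[OF sub(1) finite_R u1] .
  have sg0: "subgroup (?V (carrier G)) (units_of RG)" using norm_supported_subgroup[OF G.subgroup_self finite_R u0] .
  have card2: "card (?V G2) = 2 ^ n" using card_norm_supported[OF c2 one(2)] card q by simp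
  have card1: "card (?V G1) = 2 ^ (3 * n)" using card_norm_supported[OF c1 one(1)] card q by (simp add: power_mult[symmetric] mult.commute)
  have card0: "card (?V (carrier G)) = 2 ^ (31 * n)" using card_norm_supported[of "carrier G"] card q by (simp add: power_mult[symmetric] mult.commute)
  have fin: "finite (?V S)" for S using finite_norm_supported[OF finite_R] .
  \<comment> \<open>The squares over \<open>G2\<close> are trivial, so the empty family is a basis
    of them for any \<open>h\<close> and \<open>m\<close>; lifting it only adjoins elements of order
    2.\<close>
  have b3: "U.basis_of ((\<lambda>x. x \<otimes>\<^bsub>units_of RG\<^esub> x) ` ?V G2) 0 h m" for h m
    unfolding sq square_image[OF c2] G3 norm_supported_singleton
    using U.basis_of_one by (simp add: units_of_one)
  obtain r2 h2 where b2: "U.basis_of (?V G2) r2 h2 (\<lambda>i. 2)"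
    using U.basis_of_squares_lift[OF sg2 fin b3] by auto
  have "2 ^ r2 = (2::nat) ^ n" using U.basis_of_card[OF b2] card2 by simp
  hence r2: "r2 = n" by simp
  have "U.basis_of ((\<lambda>x. x \<otimes>\<^bsub>units_of RG\<^esub> x) ` ?V G1) n h2 (\<lambda>i. 2)"
    using b2 unfolding sq square_image[OF c1] G2 r2 .
  from U.basis_of_squares_lift[OF sg1 fin this]
  obtain r1 h1 where "U.basis_of (?V G1) (n + r1) h1 (\<lambda>i. if i < n then 2 * 2 else 2)" by auto
  moreover have "(\<lambda>i. if i < n then 2 * 2 else 2) = (\<lambda>i. if i < n then 4 else (2::nat))" by auto
  ultimately have b1: "U.basis_of (?V G1) (n + r1) h1 (\<lambda>i. if i < n then 4 else 2)" by (simp only:)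
  have split_prod: "(\<Prod>i<a + b. if i < a then f i else g i) = (\<Prod>i<a. f i) * (\<Prod>i<b. g (a + i))" for a b and f g :: "nat \<Rightarrow> nat"
    by (induction b) (auto simp: mult.assoc[symmetric])
  have "(4::nat) ^ n * 2 ^ r1 = 2 ^ (3 * n)" using U.basis_of_card[OF b1] card1 split_prod[of n "\<lambda>_. 4" "\<lambda>_. 2" r1] by simp
  also have "(4::nat) ^ n = 2 ^ (2 * n)" by (simp add: power_mult)
  finally have "(2::nat) ^ (2 * n + r1) = 2 ^ (3 * n)" by (simp add: power_add)
  hence r1: "r1 = n" by simp
  have "U.basis_of ((\<lambda>x. x \<otimes>\<^bsub>units_of RG\<^esub> x) ` ?V (carrier G)) (n + n) h1 (\<lambda>i. if i < n then 4 else 2)"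
    using b1 unfolding sq square_image[OF subset_refl] G1 r1 .
  from U.basis_of_squares_lift[OF sg0 fin this]
  have "\<exists>r0 h0. U.basis_of (?V (carrier G)) (n + n + r0) h0
      (\<lambda>i. if i < n + n then 2 * (if i < n then 4 else 2) else 2)" by simp
  then obtain r0 h0 where b0: "U.basis_of (?V (carrier G)) (n + n + r0) h0
      (\<lambda>i. if i < n + n then 2 * (if i < n then 4 else 2) else 2)" by (elim exE)
  \<comment> \<open>The factor 2 stems from the last lifting: the values are 8 below
    \<open>n\<close>, then 4 below \<open>n + n\<close>, and 2 from there on.\<close>
  let ?m = "\<lambda>i. if i < n + n then 2 * (if i < n then 4 else 2) else (2::nat)"
  have "(\<Prod>i<n + n. 2 * (if i < n then 4 else 2)) = (\<Prod>i<n + n. if i < n then 8 else (4::nat))"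
    by (intro prod.cong) auto
  also have "\<dots> = 8 ^ n * 4 ^ n" using split_prod[of n "\<lambda>_. 8" "\<lambda>_. 4" n] by simp
  finally have "(8::nat) ^ n * 4 ^ n * 2 ^ r0 = 2 ^ (31 * n)"
    using U.basis_of_card[OF b0] card0 split_prod[of "n + n" "\<lambda>i. 2 * (if i < n then 4 else 2)" "\<lambda>_. 2" r0] by simp
  also have "(8::nat) ^ n = 2 ^ (3 * n)" by (simp add: power_mult)
  also have "(4::nat) ^ n = 2 ^ (2 * n)" by (simp add: power_mult)
  finally have "(2::nat) ^ (3 * n + 2 * n + r0) = 2 ^ (31 * n)" unfolding power_add .
  hence r0: "r0 = 26 * n" by simp
  let ?A = "cyclic_power 8 n" and ?B = "cyclic_power 4 n" and ?C = "cyclic_power 2 (26 * n)"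
  let ?P = "\<lambda>(k::nat) m. product_group {..<k} (\<lambda>i. cyclic (m i))"
  have cong: "?P k m \<cong> cyclic_power l k" if "\<And>i. i < k \<Longrightarrow> m i = l" for k m l
    unfolding cyclic_power_def using that by (intro iso_product_groupI) auto
  have grp: "group (?P k m)" for k m by (intro product_group) auto
  have gp: "group (cyclic_power l k)" for l k unfolding cyclic_power_def by (intro product_group) auto
  have "?P (n + n + 26 * n) ?m \<cong> ?P (n + n) ?m \<times>\<times> ?P (26 * n) (\<lambda>i. ?m (n + n + i))"
    by (rule product_group_split)
  also have "\<dots> \<cong> (?A \<times>\<times> ?B) \<times>\<times> ?C"
  proof (rule group.DirProd_iso_trans[OF grp])
    have "?P (n + n) ?m \<cong> ?P n ?m \<times>\<times> ?P n (\<lambda>i. ?m (n + i))" by (rule product_group_split)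
    also have "\<dots> \<cong> ?A \<times>\<times> ?B" by (rule group.DirProd_iso_trans[OF grp]) (rule cong, simp)+
    finally show "?P (n + n) ?m \<cong> ?A \<times>\<times> ?B" .
    show "?P (26 * n) (\<lambda>i. ?m (n + n + i)) \<cong> ?C" by (rule cong) simp
  qed
  also have "\<dots> \<cong> ?A \<times>\<times> (?B \<times>\<times> ?C)" by (rule DirProd_assoc)
  finally have P: "?P (n + n + 26 * n) ?m \<cong> ?A \<times>\<times> (?B \<times>\<times> ?C)" .
  let ?N = "units_of RG\<lparr>carrier := ?V (carrier G)\<rparr>"
  have gN: "group ?N" using U.subgroup_imp_group[OF sg0] .
  have pn: "?P (n + n + 26 * n) ?m \<cong> ?N" using U.basis_of_iso[OF b0] unfolding r0 by (rule is_isoI)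
  have N: "?N \<cong> ?A \<times>\<times> (?B \<times>\<times> ?C)" by (rule iso_trans[OF group.iso_sym[OF grp pn] P])
  have gR: "group (units_of R)" by (rule R.units_group)
  have "units_of RG \<cong> ?N \<times>\<times> units_of R"
    by (rule group.iso_sym[OF DirProd_group[OF gN gR], OF units_of_RG_iso[OF u0]])
  also have "\<dots> \<cong> (?A \<times>\<times> (?B \<times>\<times> ?C)) \<times>\<times> cyclic (2 ^ n - 1)"
    using F.units_of_iso_cyclic[OF finite_R] unfolding q by (intro group.DirProd_iso_trans[OF gN] N)
  also have "\<dots> \<cong> ?A \<times>\<times> ((?B \<times>\<times> ?C) \<times>\<times> cyclic (2 ^ n - 1))" by (rule DirProd_assoc)
  also have "\<dots> \<cong> ?A \<times>\<times> (?B \<times>\<times> (?C \<times>\<times> cyclic (2 ^ n - 1)))"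
    by (rule group.DirProd_iso_trans[OF gp iso_refl DirProd_assoc])
  finally show ?thesis .
qed

end

section \<open>Quadratic extensions and characters\<close>

text \<open>The ring F[X]/(X^2 - d), with the pair (a, b) standing for a + b X.\<close>

definition quadratic_extension :: "('a, 'm) ring_scheme \<Rightarrow> 'a \<Rightarrow> ('a \<times> 'a) ring" where
  "quadratic_extension F d =
    \<lparr> carrier = carrier F \<times> carrier F,
      monoid.mult = (\<lambda>(a, b) (a', b').
        (a \<otimes>\<^bsub>F\<^esub> a' \<oplus>\<^bsub>F\<^esub> d \<otimes>\<^bsub>F\<^esub> (b \<otimes>\<^bsub>F\<^esub> b'), a \<otimes>\<^bsub>F\<^esub> b' \<oplus>\<^bsub>F\<^esub> b \<otimes>\<^bsub>F\<^esub> a')),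
      one = (\<one>\<^bsub>F\<^esub>, \<zero>\<^bsub>F\<^esub>),
      ring.zero = (\<zero>\<^bsub>F\<^esub>, \<zero>\<^bsub>F\<^esub>),
      ring.add = (\<lambda>(a, b) (a', b'). (a \<oplus>\<^bsub>F\<^esub> a', b \<oplus>\<^bsub>F\<^esub> b')) \<rparr>"

text \<open>A nonsquare \<open>d\<close> makes the pairs a field; \<open>two_nonzero\<close> keeps
  conjugation from being the identity, so that its fixed elements are just those with second
  coordinate zero.\<close>

locale odd_quadratic_extension = field F for F (structure) +
  fixes d
  assumes d_closed: "d \<in> carrier F"
    and d_nonsquare: "x \<in> carrier F \<Longrightarrow> x \<otimes> x \<noteq> d"
    and two_nonzero: "\<one> \<oplus> \<one> \<noteq> \<zero>"
begin

abbreviation "K \<equiv> quadratic_extension F d"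

definition conj :: "'a \<times> 'a \<Rightarrow> 'a \<times> 'a" where "conj = (\<lambda>(a, b). (a, \<ominus> b))"

definition \<iota> :: "'a \<Rightarrow> 'a \<times> 'a" where "\<iota> a = (a, \<zero>)"

lemma carrier_K: "carrier K = carrier F \<times> carrier F"
  and mult_K: "(a, b) \<otimes>\<^bsub>K\<^esub> (a', b') = (a \<otimes> a' \<oplus> d \<otimes> (b \<otimes> b'), a \<otimes> b' \<oplus> b \<otimes> a')"
  and one_K: "\<one>\<^bsub>K\<^esub> = (\<one>, \<zero>)"
  and zero_K: "\<zero>\<^bsub>K\<^esub> = (\<zero>, \<zero>)"
  and add_K: "(a, b) \<oplus>\<^bsub>K\<^esub> (a', b') = (a \<oplus> a', b \<oplus> b')"
  by (simp_all add: quadratic_extension_def)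

text \<open>If the norm vanished with \<open>b\<close> nonzero, the quotient of \<open>a\<close> by
  \<open>b\<close> would be a square root of \<open>d\<close>.\<close>

lemma norm_nonzero:
  assumes "a \<in> carrier F" "b \<in> carrier F" "(a, b) \<noteq> (\<zero>, \<zero>)"
  shows "a \<otimes> a \<ominus> d \<otimes> (b \<otimes> b) \<noteq> \<zero>"
proof
  assume "a \<otimes> a \<ominus> d \<otimes> (b \<otimes> b) = \<zero>"
  hence e: "a \<otimes> a = d \<otimes> (b \<otimes> b)" using assms d_closed by simp
  show False
  proof (cases "b = \<zero>")
    case True
    hence "a \<otimes> a = \<zero>" using e d_closed by simp
    thus False using True assms integral by auto
  next
    case False
    hence b: "b \<in> Units F" using assms field_Units by auto
    hence ib: "inv b \<in> carrier F" "b \<otimes> inv b = \<one>" by auto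
    have "(a \<otimes> inv b) \<otimes> (a \<otimes> inv b) = (a \<otimes> a) \<otimes> (inv b \<otimes> inv b)"
      using assms(1) ib(1) by (simp add: m_ac)
    also have "\<dots> = d \<otimes> ((b \<otimes> inv b) \<otimes> (b \<otimes> inv b))"
      unfolding e using assms(2) ib(1) d_closed by (simp add: m_ac)
    also have "\<dots> = d" using ib d_closed by simp
    finally show False using d_nonsquare[of "a \<otimes> inv b"] assms ib by simp
  qed
qed

lemma K_cring: "cring K"
proof (rule cringI)
  show "abelian_group K"
  proof (rule abelian_groupI)
    fix x assume "x \<in> carrier K"
    then obtain a b where x: "x = (a, b)" "a \<in> carrier F" "b \<in> carrier F" by (auto simp: carrier_K)
    show "\<exists>y\<in>carrier K. y \<oplus>\<^bsub>K\<^esub> x = \<zero>\<^bsub>K\<^esub>"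
      using x by (intro bexI[of _ "(\<ominus> a, \<ominus> b)"]) (auto simp: carrier_K add_K zero_K l_neg)
  qed (auto simp: carrier_K add_K zero_K a_ac)
  show "comm_monoid K"
  proof (rule comm_monoidI)
    fix x y z assume "x \<in> carrier K" "y \<in> carrier K" "z \<in> carrier K"
    then obtain a b a' b' a'' b'' where x: "x = (a, b)" "y = (a', b')" "z = (a'', b'')"
      and c: "a \<in> carrier F" "b \<in> carrier F" "a' \<in> carrier F" "b' \<in> carrier F" "a'' \<in> carrier F" "b'' \<in> carrier F"
      by (auto simp: carrier_K)
    show "(x \<otimes>\<^bsub>K\<^esub> y) \<otimes>\<^bsub>K\<^esub> z = x \<otimes>\<^bsub>K\<^esub> (y \<otimes>\<^bsub>K\<^esub> z)"
      unfolding x mult_K using c d_closed by (simp add: l_distr r_distr m_ac a_ac)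
  qed (auto simp: carrier_K mult_K one_K d_closed m_comm a_comm)
  fix x y z assume "x \<in> carrier K" "y \<in> carrier K" "z \<in> carrier K"
  then obtain a b a' b' a'' b'' where x: "x = (a, b)" "y = (a', b')" "z = (a'', b'')"
    and c: "a \<in> carrier F" "b \<in> carrier F" "a' \<in> carrier F" "b' \<in> carrier F" "a'' \<in> carrier F" "b'' \<in> carrier F"
    by (auto simp: carrier_K)
  show "(x \<oplus>\<^bsub>K\<^esub> y) \<otimes>\<^bsub>K\<^esub> z = x \<otimes>\<^bsub>K\<^esub> z \<oplus>\<^bsub>K\<^esub> y \<otimes>\<^bsub>K\<^esub> z"
    unfolding x mult_K add_K using c d_closed by (simp add: l_distr r_distr m_ac a_ac)
qed

text \<open>The inverse is the conjugate divided by the norm \<open>N\<close>, which lies in the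
  base field.\<close>

lemma K_field: "field K"
proof (rule cring.cring_fieldI2[OF K_cring])
  show "\<zero>\<^bsub>K\<^esub> \<noteq> \<one>\<^bsub>K\<^esub>" by (simp add: zero_K one_K)
  fix x assume "x \<in> carrier K" "x \<noteq> \<zero>\<^bsub>K\<^esub>"
  then obtain a b where x: "x = (a, b)" "a \<in> carrier F" "b \<in> carrier F" "(a, b) \<noteq> (\<zero>, \<zero>)"
    by (auto simp: carrier_K zero_K)
  define N where "N = a \<otimes> a \<ominus> d \<otimes> (b \<otimes> b)"
  have N: "N \<in> carrier F" "N \<noteq> \<zero>" using norm_nonzero x d_closed by (auto simp: N_def)
  hence "inv N \<in> carrier F" "N \<otimes> inv N = \<one>" using field_Units by auto
  then obtain M where i: "M \<in> carrier F" "N \<otimes> M = \<one>" by blast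
  have "x \<otimes>\<^bsub>K\<^esub> (a \<otimes> M, \<ominus> b \<otimes> M) = (N \<otimes> M, \<zero>)"
  proof -
    have "a \<otimes> (a \<otimes> M) \<oplus> d \<otimes> (b \<otimes> (\<ominus> b \<otimes> M)) = N \<otimes> M"
      unfolding N_def using x i d_closed by algebra
    moreover have "a \<otimes> (\<ominus> b \<otimes> M) \<oplus> b \<otimes> (a \<otimes> M) = \<zero>"
      using x i by algebra
    ultimately show ?thesis unfolding x mult_K by simp
  qed
  thus "\<exists>y\<in>carrier K. x \<otimes>\<^bsub>K\<^esub> y = \<one>\<^bsub>K\<^esub>" unfolding one_K i(2) using x i
    by (intro bexI[of _ "(a \<otimes> M, \<ominus> b \<otimes> M)"]) (auto simp: carrier_K)
qed

lemma \<iota>_hom: "\<iota> \<in> ring_hom F K"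
  by (rule ring_hom_memI) (auto simp: \<iota>_def carrier_K mult_K add_K one_K d_closed)

lemma conj_hom: "conj \<in> ring_hom K K"
proof (rule ring_hom_memI)
  fix x y assume "x \<in> carrier K" "y \<in> carrier K"
  then obtain a b a' b' where x: "x = (a, b)" "y = (a', b')"
    and c: "a \<in> carrier F" "b \<in> carrier F" "a' \<in> carrier F" "b' \<in> carrier F"
    by (auto simp: carrier_K)
  show "conj (x \<otimes>\<^bsub>K\<^esub> y) = conj x \<otimes>\<^bsub>K\<^esub> conj y"
    unfolding x mult_K conj_def using c d_closed by (simp add: mult_K l_minus r_minus minus_add)
  show "conj (x \<oplus>\<^bsub>K\<^esub> y) = conj x \<oplus>\<^bsub>K\<^esub> conj y"
    unfolding x add_K conj_def using c by (simp add: add_K minus_add)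
qed (auto simp: carrier_K one_K conj_def)

lemma conj_\<iota>: "conj (\<iota> a) = \<iota> a"
  by (simp add: conj_def \<iota>_def)

lemma conj_fixed:
  assumes "x \<in> carrier K" "conj x = x"
  shows "x = \<iota> (fst x)"
proof -
  obtain a b where x: "x = (a, b)" "a \<in> carrier F" "b \<in> carrier F" using assms by (auto simp: carrier_K)
  hence "\<ominus> b = b" using assms by (simp add: conj_def)
  hence "(\<one> \<oplus> \<one>) \<otimes> b = \<zero>" using x(3) by (metis l_distr l_neg l_one one_closed)
  hence "b = \<zero>" using two_nonzero x integral by (metis add.m_closed one_closed)
  thus ?thesis using x by (simp add: \<iota>_def)
qed

lemma \<iota>_inj: "\<iota> a = \<iota> b \<Longrightarrow> a = b"
  by (simp add: \<iota>_def)

end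

text \<open>The group indexes its own characters: \<open>w\<close> is a nondegenerate pairing of
  \<open>G\<close> with itself. Multiplicativity in the element makes evaluation multiplicative,
  multiplicativity in the index yields orthogonality, and \<open>w_one\<close> excludes the zero
  function, which is multiplicative too. \<open>order_nonzero\<close> allows the group order to be
  cancelled after inversion.\<close>

locale group_algebra_characters = odd_quadratic_extension F d + F: finite_group_algebra F G
  for F (structure) and d and G (structure) +
  fixes w :: "'c \<Rightarrow> 'c \<Rightarrow> 'a \<times> 'a"
  assumes finite_F: "finite (carrier F)"
    and w_closed: "j \<in> carrier G \<Longrightarrow> x \<in> carrier G \<Longrightarrow> w j x \<in> carrier K"
    and w_mult_right: "j \<in> carrier G \<Longrightarrow> x \<in> carrier G \<Longrightarrow> y \<in> carrier G \<Longrightarrow> w j (x \<otimes>\<^bsub>G\<^esub> y) = w j x \<otimes>\<^bsub>K\<^esub> w j y"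
    and w_mult_left: "i \<in> carrier G \<Longrightarrow> j \<in> carrier G \<Longrightarrow> x \<in> carrier G \<Longrightarrow> w (i \<otimes>\<^bsub>G\<^esub> j) x = w i x \<otimes>\<^bsub>K\<^esub> w j x"
    and w_one: "j \<in> carrier G \<Longrightarrow> w j \<one>\<^bsub>G\<^esub> = \<one>\<^bsub>K\<^esub>"
    and w_nondegenerate: "x \<in> carrier G \<Longrightarrow> x \<noteq> \<one>\<^bsub>G\<^esub> \<Longrightarrow> \<exists>j\<in>carrier G. w j x \<noteq> \<one>\<^bsub>K\<^esub>"
    and order_nonzero: "[card (carrier G)] \<cdot> \<one> \<noteq> \<zero>"
begin

sublocale K: field K by (rule K_field)

sublocale KG: finite_group_algebra K G
  by unfold_locales (rule F.finite_G)

text \<open>Shifting the index by an \<open>i\<close> with \<open>w i x\<close> different from 1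
  permutes the summands and multiplies the sum by \<open>w i x\<close>; only zero survives
  this.\<close>

lemma orthogonality:
  assumes x: "x \<in> carrier G" "x \<noteq> \<one>\<^bsub>G\<^esub>"
  shows "(\<Oplus>\<^bsub>K\<^esub>j\<in>carrier G. w j x) = \<zero>\<^bsub>K\<^esub>"
proof -
  obtain i where i: "i \<in> carrier G" "w i x \<noteq> \<one>\<^bsub>K\<^esub>" using w_nondegenerate[OF x] by blast
  let ?s = "\<Oplus>\<^bsub>K\<^esub>j\<in>carrier G. w j x"
  have sc: "?s \<in> carrier K" using w_closed x by (intro K.finsum_closed) auto
  have bij: "(\<lambda>j. i \<otimes>\<^bsub>G\<^esub> j) ` carrier G = carrier G" "inj_on (\<lambda>j. i \<otimes>\<^bsub>G\<^esub> j) (carrier G)"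
    using i F.G.surj_const_mult F.G.inj_on_cmult by auto
  have "?s = (\<Oplus>\<^bsub>K\<^esub>j\<in>(\<lambda>j. i \<otimes>\<^bsub>G\<^esub> j) ` carrier G. w j x)" using bij by simp
  also have "\<dots> = (\<Oplus>\<^bsub>K\<^esub>j\<in>carrier G. w (i \<otimes>\<^bsub>G\<^esub> j) x)"
    using bij w_closed x by (intro K.finsum_reindex) auto
  also have "\<dots> = (\<Oplus>\<^bsub>K\<^esub>j\<in>carrier G. w i x \<otimes>\<^bsub>K\<^esub> w j x)"
    using i x w_closed w_mult_left by (intro K.finsum_cong') auto
  also have "\<dots> = w i x \<otimes>\<^bsub>K\<^esub> ?s"
    using i x w_closed F.finite_G by (intro K.finsum_rdistr[symmetric]) auto
  finally have "w i x \<otimes>\<^bsub>K\<^esub> ?s = \<one>\<^bsub>K\<^esub> \<otimes>\<^bsub>K\<^esub> ?s" using sc by simp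
  thus ?thesis using i x w_closed sc K.m_rcancel[of ?s "w i x" "\<one>\<^bsub>K\<^esub>"] by auto
qed

definition "lift f = (\<lambda>x\<in>carrier G. \<iota> (f x))"

definition "ev j f = KG.pairing (lift f) (w j)"

lemma \<iota>_closed: "a \<in> carrier F \<Longrightarrow> \<iota> a \<in> carrier K"
  using \<iota>_hom by (rule ring_hom_closed)

lemma lift_closed: "f \<in> carrier F.RG \<Longrightarrow> lift f \<in> carrier KG.RG"
  by (auto simp: lift_def KG.carrier_RG F.RG_mem \<iota>_closed)

lemma w_fun: "j \<in> carrier G \<Longrightarrow> w j \<in> carrier G \<rightarrow> carrier K"
  using w_closed by auto

lemma ev_closed: "f \<in> carrier F.RG \<Longrightarrow> j \<in> carrier G \<Longrightarrow> ev j f \<in> carrier K"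
  unfolding ev_def by (intro KG.pairing_closed lift_closed w_fun)

lemma \<iota>_finsum: "f \<in> A \<rightarrow> carrier F \<Longrightarrow> \<iota> (\<Oplus>x\<in>A. f x) = (\<Oplus>\<^bsub>K\<^esub>x\<in>A. \<iota> (f x))"
proof -
  interpret h: ring_hom_cring F K \<iota> using \<iota>_hom K_cring is_cring by (intro ring_hom_cring.intro ring_hom_cring_axioms.intro)
  assume "f \<in> A \<rightarrow> carrier F"
  thus ?thesis by (simp add: h.hom_finsum o_def)
qed

lemma conj_finsum: "f \<in> A \<rightarrow> carrier K \<Longrightarrow> conj (\<Oplus>\<^bsub>K\<^esub>x\<in>A. f x) = (\<Oplus>\<^bsub>K\<^esub>x\<in>A. conj (f x))"
proof -
  interpret h: ring_hom_cring K K conj using conj_hom K_cring by (intro ring_hom_cring.intro ring_hom_cring_axioms.intro)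
  assume "f \<in> A \<rightarrow> carrier K"
  thus ?thesis by (simp add: h.hom_finsum o_def)
qed

lemma lift_mult:
  assumes f: "f \<in> carrier F.RG" and g: "g \<in> carrier F.RG"
  shows "lift (f \<otimes>\<^bsub>F.RG\<^esub> g) = lift f \<otimes>\<^bsub>KG.RG\<^esub> lift g"
proof (rule KG.RG_eqI)
  fix x assume x: "x \<in> carrier G"
  have "lift (f \<otimes>\<^bsub>F.RG\<^esub> g) x = \<iota> (\<Oplus>y\<in>carrier G. f y \<otimes> g (inv\<^bsub>G\<^esub> y \<otimes>\<^bsub>G\<^esub> x))"
    using x by (simp add: lift_def F.RG_mult[OF f g])
  also have "\<dots> = (\<Oplus>\<^bsub>K\<^esub>y\<in>carrier G. \<iota> (f y \<otimes> g (inv\<^bsub>G\<^esub> y \<otimes>\<^bsub>G\<^esub> x)))"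
    using x f g by (intro \<iota>_finsum) (auto simp: F.RG_mem)
  also have "\<dots> = (\<Oplus>\<^bsub>K\<^esub>y\<in>carrier G. lift f y \<otimes>\<^bsub>K\<^esub> lift g (inv\<^bsub>G\<^esub> y \<otimes>\<^bsub>G\<^esub> x))"
    using x f g by (intro K.finsum_cong') (auto simp: F.RG_mem \<iota>_closed lift_def ring_hom_mult[OF \<iota>_hom])
  also have "\<dots> = (lift f \<otimes>\<^bsub>KG.RG\<^esub> lift g) x"
    using x by (simp add: KG.RG_mult[OF lift_closed[OF f] lift_closed[OF g]])
  finally show "lift (f \<otimes>\<^bsub>F.RG\<^esub> g) x = (lift f \<otimes>\<^bsub>KG.RG\<^esub> lift g) x" .
qed (use f g in \<open>auto intro!: lift_closed F.RG_mult_closed KG.RG_mult_closed\<close>)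

lemma ev_mult:
  assumes "f \<in> carrier F.RG" "g \<in> carrier F.RG" "j \<in> carrier G"
  shows "ev j (f \<otimes>\<^bsub>F.RG\<^esub> g) = ev j f \<otimes>\<^bsub>K\<^esub> ev j g"
  unfolding ev_def lift_mult[OF assms(1,2)]
  by (intro KG.pairing_mult_hom lift_closed w_fun w_mult_right assms)

lemma ev_one: "j \<in> carrier G \<Longrightarrow> ev j \<one>\<^bsub>F.RG\<^esub> = \<one>\<^bsub>K\<^esub>"
proof -
  assume j: "j \<in> carrier G"
  have "lift \<one>\<^bsub>F.RG\<^esub> = \<one>\<^bsub>KG.RG\<^esub>"
    by (rule ext) (simp add: lift_def F.RG_one KG.RG_one \<iota>_def one_K zero_K)
  thus ?thesis unfolding ev_def using KG.pairing_one[OF w_fun[OF j]] w_one[OF j] by simp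
qed

text \<open>The coefficients come from \<open>F\<close> and are fixed by conjugation, which
  therefore acts on the character values alone.\<close>

lemma ev_conj:
  assumes f: "f \<in> carrier F.RG" and i: "i \<in> carrier G" and j: "j \<in> carrier G"
    and w: "\<And>x. x \<in> carrier G \<Longrightarrow> conj (w i x) = w j x"
  shows "conj (ev i f) = ev j f"
proof -
  have c: "lift f x \<in> carrier K" "w i x \<in> carrier K" "w j x \<in> carrier K" "conj (lift f x) = lift f x" if "x \<in> carrier G" for x
    using that KG.RG_mem[OF lift_closed[OF f]] w_closed i j by (auto simp: lift_def conj_\<iota>)
  have "conj (ev i f) = (\<Oplus>\<^bsub>K\<^esub>x\<in>carrier G. conj (lift f x \<otimes>\<^bsub>K\<^esub> w i x))"
    unfolding ev_def KG.pairing_def using c by (intro conj_finsum) auto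
  also have "\<dots> = ev j f"
    unfolding ev_def KG.pairing_def using c w
    by (intro K.finsum_cong') (auto simp: ring_hom_mult[OF conj_hom])
  finally show ?thesis .
qed

text \<open>Fourier inversion without the division. After the sums are exchanged, the inner sum over
  all \<open>j\<close> is the group order for \<open>y = x\<close> and vanishes otherwise by
  orthogonality.\<close>

lemma inversion:
  assumes f: "f \<in> carrier F.RG" and x: "x \<in> carrier G"
  shows "(\<Oplus>\<^bsub>K\<^esub>j\<in>carrier G. w j (inv\<^bsub>G\<^esub> x) \<otimes>\<^bsub>K\<^esub> ev j f) = \<iota> ([card (carrier G)] \<cdot> \<one> \<otimes> f x)"
proof -
  have c: "lift f y \<in> carrier K" if "y \<in> carrier G" for y using that KG.RG_mem[OF lift_closed[OF f]] by simp
  note cl = c w_closed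
  have "(\<Oplus>\<^bsub>K\<^esub>j\<in>carrier G. w j (inv\<^bsub>G\<^esub> x) \<otimes>\<^bsub>K\<^esub> ev j f) =
    (\<Oplus>\<^bsub>K\<^esub>j\<in>carrier G. \<Oplus>\<^bsub>K\<^esub>y\<in>carrier G. lift f y \<otimes>\<^bsub>K\<^esub> w j (inv\<^bsub>G\<^esub> x \<otimes>\<^bsub>G\<^esub> y))"
  proof (intro K.finsum_cong' refl)
    fix j assume j: "j \<in> carrier G"
    have "w j (inv\<^bsub>G\<^esub> x) \<otimes>\<^bsub>K\<^esub> ev j f = (\<Oplus>\<^bsub>K\<^esub>y\<in>carrier G. w j (inv\<^bsub>G\<^esub> x) \<otimes>\<^bsub>K\<^esub> (lift f y \<otimes>\<^bsub>K\<^esub> w j y))"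
      unfolding ev_def KG.pairing_def using F.finite_G cl j x by (intro K.finsum_rdistr) auto
    also have "\<dots> = (\<Oplus>\<^bsub>K\<^esub>y\<in>carrier G. lift f y \<otimes>\<^bsub>K\<^esub> w j (inv\<^bsub>G\<^esub> x \<otimes>\<^bsub>G\<^esub> y))"
      using cl j x by (intro K.finsum_cong') (auto simp: w_mult_right K.m_lcomm)
    finally show "w j (inv\<^bsub>G\<^esub> x) \<otimes>\<^bsub>K\<^esub> ev j f = (\<Oplus>\<^bsub>K\<^esub>y\<in>carrier G. lift f y \<otimes>\<^bsub>K\<^esub> w j (inv\<^bsub>G\<^esub> x \<otimes>\<^bsub>G\<^esub> y))" .
  qed (use cl x in \<open>auto intro!: K.finsum_closed\<close>)
  also have "\<dots> = (\<Oplus>\<^bsub>K\<^esub>y\<in>carrier G. \<Oplus>\<^bsub>K\<^esub>j\<in>carrier G. lift f y \<otimes>\<^bsub>K\<^esub> w j (inv\<^bsub>G\<^esub> x \<otimes>\<^bsub>G\<^esub> y))"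
    using F.finite_G cl x by (intro K.finsum_swap) auto
  also have "\<dots> = (\<Oplus>\<^bsub>K\<^esub>y\<in>carrier G. (lift f y \<otimes>\<^bsub>K\<^esub> \<iota> ([card (carrier G)] \<cdot> \<one>)) \<otimes>\<^bsub>K\<^esub> (if y = x then \<one>\<^bsub>K\<^esub> else \<zero>\<^bsub>K\<^esub>))"
  proof (intro K.finsum_cong' refl)
    fix y assume y: "y \<in> carrier G"
    have "(\<Oplus>\<^bsub>K\<^esub>j\<in>carrier G. lift f y \<otimes>\<^bsub>K\<^esub> w j (inv\<^bsub>G\<^esub> x \<otimes>\<^bsub>G\<^esub> y)) =
        lift f y \<otimes>\<^bsub>K\<^esub> (\<Oplus>\<^bsub>K\<^esub>j\<in>carrier G. w j (inv\<^bsub>G\<^esub> x \<otimes>\<^bsub>G\<^esub> y))"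
      using F.finite_G cl x y by (intro K.finsum_rdistr[symmetric]) auto
    also have "(\<Oplus>\<^bsub>K\<^esub>j\<in>carrier G. w j (inv\<^bsub>G\<^esub> x \<otimes>\<^bsub>G\<^esub> y)) = (if y = x then \<iota> ([card (carrier G)] \<cdot> \<one>) else \<zero>\<^bsub>K\<^esub>)"
    proof (cases "y = x")
      case True
      have "(\<Oplus>\<^bsub>K\<^esub>j\<in>carrier G. w j \<one>\<^bsub>G\<^esub>) = (\<Oplus>\<^bsub>K\<^esub>j\<in>carrier G. \<iota> \<one>)"
        using w_one by (intro K.finsum_cong') (auto simp: ring_hom_one[OF \<iota>_hom])
      also have "\<dots> = \<iota> (\<Oplus>j\<in>carrier G. \<one>)" by (rule \<iota>_finsum[symmetric]) auto
      also have "(\<Oplus>j\<in>carrier G. \<one>) = [card (carrier G)] \<cdot> \<one>" by (rule add.finprod_const) simp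
      finally show ?thesis using True x by simp
    next
      case False
      hence "inv\<^bsub>G\<^esub> x \<otimes>\<^bsub>G\<^esub> y \<noteq> \<one>\<^bsub>G\<^esub>" using x y by (metis F.G.inv_closed F.G.inv_equality F.G.inv_inv F.G.m_comm)
      thus ?thesis using False orthogonality x y by simp
    qed
    finally show "(\<Oplus>\<^bsub>K\<^esub>j\<in>carrier G. lift f y \<otimes>\<^bsub>K\<^esub> w j (inv\<^bsub>G\<^esub> x \<otimes>\<^bsub>G\<^esub> y)) =
        (lift f y \<otimes>\<^bsub>K\<^esub> \<iota> ([card (carrier G)] \<cdot> \<one>)) \<otimes>\<^bsub>K\<^esub> (if y = x then \<one>\<^bsub>K\<^esub> else \<zero>\<^bsub>K\<^esub>)"
      using c[OF y] \<iota>_closed[OF add.nat_pow_closed[OF one_closed]] by (cases "y = x") simp_all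
  qed (use c \<iota>_closed in auto)
  also have "\<dots> = lift f x \<otimes>\<^bsub>K\<^esub> \<iota> ([card (carrier G)] \<cdot> \<one>)"
    using F.finite_G x c \<iota>_closed by (intro K.finsum_indicator) auto
  also have "\<dots> = \<iota> (f x \<otimes> [card (carrier G)] \<cdot> \<one>)"
    using x f by (simp add: lift_def F.RG_mem ring_hom_mult[OF \<iota>_hom])
  finally show ?thesis using x f by (simp add: F.RG_mem m_comm)
qed

text \<open>Inversion recovers each coefficient up to the group order, which is nonzero in the field
  and can be cancelled.\<close>

lemma ev_inj:
  assumes f: "f \<in> carrier F.RG" and g: "g \<in> carrier F.RG"
    and e: "\<And>j. j \<in> carrier G \<Longrightarrow> ev j f = ev j g"
  shows "f = g"
proof (rule F.RG_eqI[OF f g])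
  fix x assume x: "x \<in> carrier G"
  have "(\<Oplus>\<^bsub>K\<^esub>j\<in>carrier G. w j (inv\<^bsub>G\<^esub> x) \<otimes>\<^bsub>K\<^esub> ev j f) = (\<Oplus>\<^bsub>K\<^esub>j\<in>carrier G. w j (inv\<^bsub>G\<^esub> x) \<otimes>\<^bsub>K\<^esub> ev j g)"
    using e x g w_closed ev_closed by (intro K.finsum_cong') auto
  hence "[card (carrier G)] \<cdot> \<one> \<otimes> f x = [card (carrier G)] \<cdot> \<one> \<otimes> g x"
    unfolding inversion[OF f x] inversion[OF g x] by (rule \<iota>_inj)
  thus "f x = g x" using order_nonzero f g x m_lcancel[of "[card (carrier G)] \<cdot> \<one>" "f x" "g x"] by (simp add: F.RG_mem)
qed

text \<open>The value dropped from each conjugate pair is the conjugate of the kept one, which gives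
  injectivity; \<open>card\<close> equates the numbers of elements on both sides, which gives
  surjectivity. Multiplicativity then carries the bijection over to units.\<close>

theorem units_iso:
  assumes e1: "\<And>i. i < n1 \<Longrightarrow> e1 i \<in> carrier G" and e2: "\<And>i. i < n2 \<Longrightarrow> e2 i \<in> carrier G"
    and fixed: "\<And>i x. i < n1 \<Longrightarrow> x \<in> carrier G \<Longrightarrow> conj (w (e1 i) x) = w (e1 i) x"
    and cover: "\<And>j. j \<in> carrier G \<Longrightarrow> (\<exists>i<n1. j = e1 i) \<or> (\<exists>i<n2. j = e2 i) \<or>
        (\<exists>i<n2. \<forall>x\<in>carrier G. conj (w (e2 i) x) = w j x)"
    and card: "card (carrier G) = n1 + 2 * n2" and q: "card (carrier F) = q"
  shows "units_of F.RG \<cong> cyclic_power (q - 1) n1 \<times>\<times> cyclic_power (q ^ 2 - 1) n2"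
proof -
  interpret M: comm_monoid F.RG by (rule F.RG_comm_monoid)
  have finK: "finite (carrier K)" "card (carrier K) = q ^ 2"
    using finite_F q by (auto simp: carrier_K power2_eq_square card_cartesian_product)
  let ?T = "({..<n1} \<rightarrow>\<^sub>E carrier F) \<times> ({..<n2} \<rightarrow>\<^sub>E carrier K)"
  \<comment> \<open>A value fixed by conjugation has second coordinate zero, so \<open>fst\<close>
    turns it into an element of \<open>F\<close>.\<close>
  define \<Phi> where "\<Phi> f = (\<lambda>i\<in>{..<n1}. fst (ev (e1 i) f), \<lambda>i\<in>{..<n2}. ev (e2 i) f)" for f
  have ev1: "ev (e1 i) f = \<iota> (fst (ev (e1 i) f))" if "i < n1" "f \<in> carrier F.RG" for i f
    using that fixed by (intro conj_fixed ev_closed ev_conj e1) auto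
  have ev1c: "fst (ev (e1 i) f) \<in> carrier F" if "i < n1" "f \<in> carrier F.RG" for i f
    using ev_closed[OF that(2) e1[OF that(1)]] by (auto simp: carrier_K)
  have \<Phi>T: "\<Phi> f \<in> ?T" if "f \<in> carrier F.RG" for f
    using ev1c[OF _ that] ev_closed[OF that e2] by (simp add: \<Phi>_def restrict_PiE_iff)
  have inj: "f = g" if f: "f \<in> carrier F.RG" and g: "g \<in> carrier F.RG" and e: "\<Phi> f = \<Phi> g" for f g
  proof (rule ev_inj[OF f g])
    have r1: "(\<lambda>i\<in>{..<n1}. fst (ev (e1 i) f)) = (\<lambda>i\<in>{..<n1}. fst (ev (e1 i) g))"
      and r2: "(\<lambda>i\<in>{..<n2}. ev (e2 i) f) = (\<lambda>i\<in>{..<n2}. ev (e2 i) g)"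
      using e by (simp_all add: \<Phi>_def)
    have q1: "ev (e1 i) f = ev (e1 i) g" if "i < n1" for i
    proof -
      have "fst (ev (e1 i) f) = fst (ev (e1 i) g)" using fun_cong[OF r1, of i] that by simp
      thus ?thesis using ev1[OF that f] ev1[OF that g] by simp
    qed
    have q2: "ev (e2 i) f = ev (e2 i) g" if "i < n2" for i
      using fun_cong[OF r2, of i] that by simp
    fix j assume j: "j \<in> carrier G"
    from cover[OF j] consider i where "i < n1" "j = e1 i" | i where "i < n2" "j = e2 i"
      | i where "i < n2" "\<forall>x\<in>carrier G. conj (w (e2 i) x) = w j x" by blast
    thus "ev j f = ev j g"
    proof cases
      case 3
      have "conj (ev (e2 i) f) = ev j f" "conj (ev (e2 i) g) = ev j g"
        using ev_conj[OF f e2[OF 3(1)] j] ev_conj[OF g e2[OF 3(1)] j] 3(2) by auto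
      thus ?thesis using q2[OF 3(1)] by simp
    qed (use q1 q2 in simp_all)
  qed
  have finT: "finite ?T" using finite_F finK by (auto intro!: finite_PiE)
  have img: "\<Phi> ` carrier F.RG = ?T"
  proof (rule card_subset_eq[OF finT])
    show "\<Phi> ` carrier F.RG \<subseteq> ?T" using \<Phi>T by blast
    have "card (\<Phi> ` carrier F.RG) = card (carrier F.RG)"
      by (rule card_image) (use inj in \<open>auto intro: inj_onI\<close>)
    also have "\<dots> = q ^ (n1 + 2 * n2)"
      unfolding F.carrier_RG using F.finite_G by (simp add: card_funcsetE q card)
    also have "\<dots> = card ?T"
      using finK q by (simp add: card_cartesian_product card_funcsetE power_add power_mult)
    finally show "card (\<Phi> ` carrier F.RG) = card ?T" .
  qed
  let ?P1 = "product_group {..<n1} (\<lambda>_. units_of F)" and ?P2 = "product_group {..<n2} (\<lambda>_. units_of K)"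
  have gF: "group (units_of F)" and gK: "group (units_of K)" using units_group K.units_group by auto
  have \<Phi>mult: "\<Phi> (f \<otimes>\<^bsub>F.RG\<^esub> g) = \<Phi> f \<otimes>\<^bsub>?P1 \<times>\<times> ?P2\<^esub> \<Phi> g" if f: "f \<in> carrier F.RG" and g: "g \<in> carrier F.RG" for f g
  proof -
    have "fst (ev (e1 i) (f \<otimes>\<^bsub>F.RG\<^esub> g)) = fst (ev (e1 i) f) \<otimes> fst (ev (e1 i) g)" if i: "i < n1" for i
    proof -
      have "\<iota> (fst (ev (e1 i) (f \<otimes>\<^bsub>F.RG\<^esub> g))) = ev (e1 i) (f \<otimes>\<^bsub>F.RG\<^esub> g)"
        using ev1[OF i F.RG_mult_closed[OF f g]] by simp
      also have "\<dots> = ev (e1 i) f \<otimes>\<^bsub>K\<^esub> ev (e1 i) g" by (rule ev_mult[OF f g e1[OF i]])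
      also have "\<dots> = \<iota> (fst (ev (e1 i) f)) \<otimes>\<^bsub>K\<^esub> \<iota> (fst (ev (e1 i) g))"
        using ev1[OF i f] ev1[OF i g] by simp
      also have "\<dots> = \<iota> (fst (ev (e1 i) f) \<otimes> fst (ev (e1 i) g))"
        using ev1c[OF i f] ev1c[OF i g] by (simp add: ring_hom_mult[OF \<iota>_hom])
      finally show ?thesis by (rule \<iota>_inj)
    qed
    moreover have "ev (e2 i) (f \<otimes>\<^bsub>F.RG\<^esub> g) = ev (e2 i) f \<otimes>\<^bsub>K\<^esub> ev (e2 i) g" if "i < n2" for i
      by (rule ev_mult[OF f g e2[OF that]])
    ultimately show ?thesis by (simp add: \<Phi>_def units_of_mult cong: restrict_cong)
  qed
  have \<Phi>one: "\<Phi> \<one>\<^bsub>F.RG\<^esub> = \<one>\<^bsub>?P1 \<times>\<times> ?P2\<^esub>"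
    using e1 e2 by (simp add: \<Phi>_def units_of_one ev_one one_K cong: restrict_cong)
  have PT: "carrier (?P1 \<times>\<times> ?P2) \<subseteq> ?T"
    by (auto simp: units_of_carrier Units_def PiE_iff)
  interpret P: group "?P1 \<times>\<times> ?P2" using gF gK by (intro DirProd_group product_group) auto
  have units_img: "\<Phi> f \<in> carrier (?P1 \<times>\<times> ?P2)" if f: "f \<in> Units F.RG" for f
  proof -
    have fc: "f \<in> carrier F.RG" "inv\<^bsub>F.RG\<^esub> f \<in> carrier F.RG" "f \<otimes>\<^bsub>F.RG\<^esub> inv\<^bsub>F.RG\<^esub> f = \<one>\<^bsub>F.RG\<^esub>" using f by auto
    have u: "ev j f \<noteq> \<zero>\<^bsub>K\<^esub>" if "j \<in> carrier G" for j
    proof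
      assume z: "ev j f = \<zero>\<^bsub>K\<^esub>"
      have "ev j f \<otimes>\<^bsub>K\<^esub> ev j (inv\<^bsub>F.RG\<^esub> f) = \<one>\<^bsub>K\<^esub>"
        using ev_mult[OF fc(1,2) that] fc(3) ev_one[OF that] by simp
      thus False using z ev_closed[OF fc(2) that] by simp
    qed
    have "fst (ev (e1 i) f) \<in> Units F" if "i < n1" for i
      using u[OF e1[OF that]] ev1[OF that fc(1)] ev1c[OF that fc(1)] by (auto simp: field_Units \<iota>_def zero_K)
    moreover have "ev (e2 i) f \<in> Units K" if "i < n2" for i
      using u[OF e2[OF that]] ev_closed[OF fc(1) e2[OF that]] by (simp add: K.field_Units)
    ultimately show ?thesis by (simp add: \<Phi>_def units_of_carrier restrict_PiE_iff)
  qed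
  have "\<Phi> \<in> iso (units_of F.RG) (?P1 \<times>\<times> ?P2)"
    unfolding iso_iff
  proof (intro conjI)
    show "\<Phi> \<in> hom (units_of F.RG) (?P1 \<times>\<times> ?P2)"
      using units_img \<Phi>mult unfolding units_of_carrier units_of_mult by (intro homI) (simp_all only: units_of_carrier units_of_mult M.Units_closed)
    show "inj_on \<Phi> (carrier (units_of F.RG))" using inj by (intro inj_onI) (auto simp: units_of_carrier)
    show "\<Phi> ` carrier (units_of F.RG) = carrier (?P1 \<times>\<times> ?P2)"
    proof (intro equalityI subsetI)
      fix y assume "y \<in> \<Phi> ` carrier (units_of F.RG)"
      thus "y \<in> carrier (?P1 \<times>\<times> ?P2)" using units_img unfolding units_of_carrier by blast
    next
      fix y assume y: "y \<in> carrier (?P1 \<times>\<times> ?P2)"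
      \<comment> \<open>Both \<open>y\<close> and its inverse have preimages in the group algebra;
        their product maps to the identity, so by injectivity it is the identity and the preimage of
        \<open>y\<close> is a unit.\<close>
      have "y \<in> \<Phi> ` carrier F.RG" "inv\<^bsub>?P1 \<times>\<times> ?P2\<^esub> y \<in> \<Phi> ` carrier F.RG"
        using y P.inv_closed PT unfolding img by blast+
      then obtain f g where fg: "f \<in> carrier F.RG" "g \<in> carrier F.RG"
        and yf: "y = \<Phi> f" and yg: "inv\<^bsub>?P1 \<times>\<times> ?P2\<^esub> y = \<Phi> g" by blast
      have "\<Phi> (f \<otimes>\<^bsub>F.RG\<^esub> g) = \<Phi> \<one>\<^bsub>F.RG\<^esub>"
        unfolding \<Phi>mult[OF fg] \<Phi>one yf[symmetric] yg[symmetric] by (rule P.r_inv[OF y])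
      hence "f \<otimes>\<^bsub>F.RG\<^esub> g = \<one>\<^bsub>F.RG\<^esub>" by (rule inj[OF F.RG_mult_closed[OF fg] F.RG_one_closed])
      hence "f \<in> Units F.RG" using M.unit_factor[OF _ fg] by simp
      thus "y \<in> \<Phi> ` carrier (units_of F.RG)" unfolding yf units_of_carrier by (rule imageI)
    qed
  qed
  hence "units_of F.RG \<cong> ?P1 \<times>\<times> ?P2" by (rule is_isoI)
  also have "\<dots> \<cong> cyclic_power (q - 1) n1 \<times>\<times> cyclic_power (q ^ 2 - 1) n2"
  proof (rule group.DirProd_iso_trans)
    show "group ?P1" using gF by (intro product_group)
    show "?P1 \<cong> cyclic_power (q - 1) n1" unfolding cyclic_power_def
      using units_of_iso_cyclic[OF finite_F] gF unfolding q by (intro iso_product_groupI) auto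
    show "?P2 \<cong> cyclic_power (q ^ 2 - 1) n2" unfolding cyclic_power_def
      using K.units_of_iso_cyclic[OF finK(1)] gK unfolding finK(2) by (intro iso_product_groupI) auto
  qed
  finally show ?thesis .
qed

end

text \<open>A version with sets instead of enumerations, in which orbit representatives can be
  listed explicitly.\<close>

lemma (in group_algebra_characters) units_iso_sets:
  assumes R: "R1 \<subseteq> carrier G" "R2 \<subseteq> carrier G"
    and fixed: "\<And>j x. j \<in> R1 \<Longrightarrow> x \<in> carrier G \<Longrightarrow> conj (w j x) = w j x"
    and cover: "\<And>j. j \<in> carrier G \<Longrightarrow> j \<in> R1 \<or> j \<in> R2 \<or> (\<exists>i\<in>R2. \<forall>x\<in>carrier G. conj (w i x) = w j x)"
    and card: "card (carrier G) = card R1 + 2 * card R2" and q: "card (carrier F) = q"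
  shows "units_of F.RG \<cong> cyclic_power (q - 1) (card R1) \<times>\<times> cyclic_power (q ^ 2 - 1) (card R2)"
proof -
  have fin: "finite R1" "finite R2" using R F.finite_G finite_subset by blast+
  obtain e1 where e1: "bij_betw e1 {0..<card R1} R1" using ex_bij_betw_nat_finite[OF fin(1)] by blast
  obtain e2 where e2: "bij_betw e2 {0..<card R2} R2" using ex_bij_betw_nat_finite[OF fin(2)] by blast
  have R1: "R1 = e1 ` {0..<card R1}" and R2: "R2 = e2 ` {0..<card R2}"
    using e1 e2 by (simp_all add: bij_betw_def)
  have m1: "e1 i \<in> R1" if "i < card R1" for i using e1 that by (auto dest: bij_betwE)
  have m2: "e2 i \<in> R2" if "i < card R2" for i using e2 that by (auto dest: bij_betwE)
  show ?thesis
  proof (rule units_iso[of _ e1 _ e2])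
    fix j assume "j \<in> carrier G"
    from cover[OF this] show "(\<exists>i<card R1. j = e1 i) \<or> (\<exists>i<card R2. j = e2 i) \<or>
        (\<exists>i<card R2. \<forall>x\<in>carrier G. conj (w (e2 i) x) = w j x)"
    proof (elim disjE)
      assume "j \<in> R1"
      thus ?thesis by (subst (asm) R1) auto
    next
      assume "j \<in> R2"
      thus ?thesis by (subst (asm) R2) auto
    next
      assume "\<exists>i\<in>R2. \<forall>x\<in>carrier G. conj (w i x) = w j x"
      thus ?thesis by (subst (asm) R2) auto
    qed
  qed (use m1 m2 R fixed card q in auto)
qed

section \<open>Conjugation on eighth roots of unity\<close>

context odd_quadratic_extension
begin

text \<open>By Lagrange every unit of \<open>F\<close> is a root of x^(q - 1) = 1, and the field
  \<open>K\<close> has at most q - 1 such roots; so they are exactly the nonzero fixed elements.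
  This takes the place of a formula for conjugation as a power map.\<close>

lemma conj_fixed_iff:
  assumes fin: "finite (carrier F)" and x: "x \<in> Units K"
  shows "conj x = x \<longleftrightarrow> x [^]\<^bsub>units_of K\<^esub> (card (carrier F) - 1) = \<one>\<^bsub>units_of K\<^esub>"
proof -
  interpret K: field K by (rule K_field)
  interpret UF: group "units_of F" by (rule units_group)
  interpret h: ring_hom_cring F K \<iota>
    using \<iota>_hom K_cring is_cring by (intro ring_hom_cring.intro ring_hom_cring_axioms.intro)
  let ?n = "card (carrier F) - 1"
  have finK: "finite (carrier K)" using fin by (simp add: carrier_K)
  have n: "?n \<noteq> 0" using card_Units[OF fin] by simp
  let ?A = "{x \<in> carrier K. x [^]\<^bsub>K\<^esub> ?n = \<one>\<^bsub>K\<^esub>}"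
  have sub: "\<iota> ` Units F \<subseteq> ?A"
  proof
    fix y assume "y \<in> \<iota> ` Units F"
    then obtain a where a: "y = \<iota> a" "a \<in> Units F" by blast
    have "a [^]\<^bsub>units_of F\<^esub> order (units_of F) = \<one>\<^bsub>units_of F\<^esub>"
      using a(2) by (intro UF.pow_order_eq_1) (simp add: units_of_carrier)
    hence "a [^] ?n = \<one>"
      using card_Units(1)[OF fin] units_of_pow[OF a(2)] by (simp add: order_def units_of_carrier units_of_one)
    moreover have "\<iota> (a [^] m) = \<iota> a [^]\<^bsub>K\<^esub> m" for m :: nat
      using Units_closed[OF a(2)] by (induction m) simp_all
    ultimately have "\<iota> a [^]\<^bsub>K\<^esub> ?n = \<one>\<^bsub>K\<^esub>" using h.hom_one by metis
    thus "y \<in> ?A" using a h.hom_closed[OF Units_closed[OF a(2)]] by simp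
  qed
  have "card (\<iota> ` Units F) = ?n"
    using card_Units(1)[OF fin] \<iota>_inj by (subst card_image) (auto intro: inj_onI)
  hence eq: "\<iota> ` Units F = ?A"
    using K.num_roots_le_deg[OF finK n] finK sub by (intro card_seteq) auto
  have xA: "x [^]\<^bsub>units_of K\<^esub> ?n = \<one>\<^bsub>units_of K\<^esub> \<longleftrightarrow> x \<in> ?A"
    using K.units_of_pow[OF x] x by (simp add: units_of_one K.Units_closed)
  show ?thesis
  proof
    assume "conj x = x"
    hence x\<iota>: "x = \<iota> (fst x)" using x K.Units_closed by (intro conj_fixed) auto
    have "fst x \<noteq> \<zero>"
    proof
      assume z: "fst x = \<zero>"
      note x\<iota>
      also have "\<iota> (fst x) = \<zero>\<^bsub>K\<^esub>" unfolding z by (simp add: \<iota>_def zero_K)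
      finally show False using x K.field_Units by simp
    qed
    moreover have "fst x \<in> carrier F" using x K.Units_closed[of x] by (auto simp: carrier_K)
    ultimately have "fst x \<in> Units F" by (simp add: field_Units)
    hence "x \<in> \<iota> ` Units F" using x\<iota> by blast
    thus "x [^]\<^bsub>units_of K\<^esub> ?n = \<one>\<^bsub>units_of K\<^esub>" unfolding xA eq .
  next
    assume "x [^]\<^bsub>units_of K\<^esub> ?n = \<one>\<^bsub>units_of K\<^esub>"
    hence "x \<in> \<iota> ` Units F" unfolding xA eq .
    thus "conj x = x" using conj_\<iota> by auto
  qed
qed

lemma conj_hom_units: "conj \<in> hom (units_of K) (units_of K)"
proof (rule homI)
  interpret K: field K by (rule K_field)
  fix x assume "x \<in> carrier (units_of K)"
  hence x: "x \<in> Units K" by (simp add: units_of_carrier)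
  have "conj x \<otimes>\<^bsub>K\<^esub> conj (inv\<^bsub>K\<^esub> x) = \<one>\<^bsub>K\<^esub>"
    using x K.Units_closed[OF x] ring_hom_mult[OF conj_hom, of x "inv\<^bsub>K\<^esub> x"] ring_hom_one[OF conj_hom] by simp
  hence "conj x \<in> Units K"
    using x K.Units_closed[OF x] ring_hom_closed[OF conj_hom] K.unit_factor[of "conj x" "conj (inv\<^bsub>K\<^esub> x)"] by simp
  thus "conj x \<in> carrier (units_of K)" by (simp add: units_of_carrier)
  fix y assume "y \<in> carrier (units_of K)"
  thus "conj (x \<otimes>\<^bsub>units_of K\<^esub> y) = conj x \<otimes>\<^bsub>units_of K\<^esub> conj y"
    using x K.Units_closed ring_hom_mult[OF conj_hom] by (simp add: units_of_carrier units_of_mult)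
qed

text \<open>\<open>\<zeta>\<close> is a power of a generator of the unit group of \<open>K\<close>.
  Its powers are all the eighth roots of unity, and its conjugate is one of them, which defines
  \<open>s\<close>. The last equivalence states in two ways that the n-th power of
  \<open>\<zeta>\<close> is fixed by conjugation.\<close>

lemma eighth_root:
  assumes fin: "finite (carrier F)" and q: "card (carrier F) = q" and odd: "odd q"
  obtains \<zeta> s where "\<zeta> \<in> Units K" "group.ord (units_of K) \<zeta> = 8" "s \<in> {0..<8}"
    "\<And>n::int. conj (\<zeta> [^]\<^bsub>units_of K\<^esub> n) = \<zeta> [^]\<^bsub>units_of K\<^esub> (s * n)"
    "\<And>n::int. 8 dvd (s - 1) * n \<longleftrightarrow> 8 dvd (int q - 1) * n"
proof -
  interpret K: field K by (rule K_field)
  interpret U: group "units_of K" by (rule K.units_group)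
  have finK: "finite (carrier K)" and cardK: "card (carrier K) = q ^ 2"
    using fin q by (simp_all add: carrier_K power2_eq_square card_cartesian_product)
  have q0: "q > 0" using odd by (cases q) auto
  obtain a where a: "a \<in> Units K" and orda: "U.ord a = q ^ 2 - 1"
    using K.units_generator[OF finK] cardK by auto
  \<comment> \<open>For \<open>q = 2 * k + 1\<close> the number is \<open>4 * (k * (k + 1))\<close>,
    and one of two consecutive numbers is even.\<close>
  have "8 dvd q ^ 2 - 1"
  proof -
    obtain k where k: "q = 2 * k + 1" using odd by (elim oddE)
    have "q ^ 2 - 1 = 4 * (k * (k + 1))" unfolding k by (simp add: power2_eq_square algebra_simps)
    moreover obtain b where "k * (k + 1) = 2 * b" by (rule evenE[of "k * (k + 1)"]) simp
    ultimately have "q ^ 2 - 1 = 8 * b" by simp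
    thus ?thesis by simp
  qed
  then obtain r where r: "q ^ 2 - 1 = 8 * r" by (elim dvdE)
  have "q ^ 2 - 1 > 0" using K.card_Units[OF finK] cardK by simp
  hence r0: "r \<noteq> 0" using r by auto
  define \<zeta> where "\<zeta> = a [^]\<^bsub>units_of K\<^esub> r"
  have \<zeta>c: "\<zeta> \<in> carrier (units_of K)" unfolding \<zeta>_def using a by (intro U.nat_pow_closed) (simp add: units_of_carrier)
  hence \<zeta>: "\<zeta> \<in> Units K" by (simp add: units_of_carrier)
  have ord: "U.ord \<zeta> = 8"
    unfolding \<zeta>_def using a r r0 orda by (subst U.ord_pow) (simp_all add: units_of_carrier)
  interpret c: group_hom "units_of K" "units_of K" conj
    by (intro group_hom.intro group_hom_axioms.intro U.is_group conj_hom_units)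
  let ?A = "{x \<in> carrier K. x [^]\<^bsub>K\<^esub> (8::nat) = \<one>\<^bsub>K\<^esub>}"
  have pow8: "x [^]\<^bsub>K\<^esub> (8::nat) = \<one>\<^bsub>K\<^esub> \<longleftrightarrow> x [^]\<^bsub>units_of K\<^esub> (8::nat) = \<one>\<^bsub>units_of K\<^esub>" if "x \<in> Units K" for x
    using K.units_of_pow[OF that] by (simp add: units_of_one)
  let ?p = "\<lambda>i::int. \<zeta> [^]\<^bsub>units_of K\<^esub> i"
  have pU: "?p i \<in> Units K" for i using U.int_pow_closed[OF \<zeta>c] by (simp add: units_of_carrier)
  have "?p i \<in> ?A" for i
  proof -
    have "?p i [^]\<^bsub>units_of K\<^esub> (8::nat) = ?p (i * 8)"
      using U.int_pow_pow[OF \<zeta>c, of i 8] int_pow_int[of "units_of K" "?p i" 8] by simp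
    also have "\<dots> = \<one>\<^bsub>units_of K\<^esub>" unfolding U.int_pow_eq_id[OF \<zeta>c] ord by simp
    finally show ?thesis using pow8[OF pU] pU K.Units_closed by simp
  qed
  hence sub: "?p ` {0..<8} \<subseteq> ?A" by blast
  have "inj_on ?p {0..<8}"
    by (rule inj_onI) (auto simp: U.int_pow_eq[OF \<zeta>c] ord mod_eq_dvd_iff[symmetric])
  hence "card (?p ` {0..<8}) = 8" by (simp add: card_image)
  hence eq: "?p ` {0..<8} = ?A"
    using K.num_roots_le_deg[OF finK, of 8] finK sub by (intro card_seteq) auto
  have cU: "conj \<zeta> \<in> Units K" using c.hom_closed[OF \<zeta>c] by (simp add: units_of_carrier)
  have "conj \<zeta> [^]\<^bsub>units_of K\<^esub> (8::nat) = conj (\<zeta> [^]\<^bsub>units_of K\<^esub> (8::nat))"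
    by (rule c.hom_nat_pow[OF \<zeta>c, symmetric])
  also have "\<zeta> [^]\<^bsub>units_of K\<^esub> (8::nat) = \<one>\<^bsub>units_of K\<^esub>" using U.pow_eq_id[OF \<zeta>c] ord by simp
  finally have "conj \<zeta> \<in> ?A" using pow8[OF cU] cU K.Units_closed c.hom_one by simp
  then obtain s where s: "s \<in> {0..<8}" "conj \<zeta> = ?p s" unfolding eq[symmetric] by blast
  have cp: "conj (?p n) = ?p (s * n)" for n
    using c.hom_int_pow[OF \<zeta>c, of n] s(2) U.int_pow_pow[OF \<zeta>c, of s n] by simp
  have "8 dvd (s - 1) * n \<longleftrightarrow> 8 dvd (int q - 1) * n" for n
  proof -
    have "8 dvd (s - 1) * n \<longleftrightarrow> conj (?p n) = ?p n"
      unfolding cp U.int_pow_eq[OF \<zeta>c] ord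
      by (metis dvd_minus_iff left_diff_distrib minus_diff_eq mult_1 of_nat_numeral)
    also have "\<dots> \<longleftrightarrow> ?p n [^]\<^bsub>units_of K\<^esub> (q - 1) = \<one>\<^bsub>units_of K\<^esub>"
      using conj_fixed_iff[OF fin pU] q by simp
    also have "?p n [^]\<^bsub>units_of K\<^esub> (q - 1) = ?p (n * int (q - 1))"
      using U.int_pow_pow[OF \<zeta>c, of n "int (q - 1)"] int_pow_int[of "units_of K" "?p n" "q - 1"] by simp
    also have "\<dots> = \<one>\<^bsub>units_of K\<^esub> \<longleftrightarrow> 8 dvd n * int (q - 1)"
      unfolding U.int_pow_eq_id[OF \<zeta>c] ord by simp
    also have "int (q - 1) = int q - 1" using q0 by simp
    finally show ?thesis by (simp add: mult.commute)
  qed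
  thus ?thesis using that[OF \<zeta> ord s(1) cp] by blast
qed

end

text \<open>Otherwise squaring would be surjective on a finite set and hence injective, although 1
  and -1 are distinct with the same square.\<close>

lemma (in field) exists_nonsquare:
  assumes fin: "finite (carrier R)" and two: "\<one> \<oplus> \<one> \<noteq> \<zero>"
  shows "\<exists>d\<in>carrier R. \<forall>x\<in>carrier R. x \<otimes> x \<noteq> d"
proof (rule ccontr)
  assume "\<not> ?thesis"
  hence sq: "\<exists>x\<in>carrier R. x \<otimes> x = d" if "d \<in> carrier R" for d using that by blast
  have "carrier R \<subseteq> (\<lambda>x. x \<otimes> x) ` carrier R"
  proof
    fix d assume "d \<in> carrier R"
    thus "d \<in> (\<lambda>x. x \<otimes> x) ` carrier R" using sq[of d] by auto
  qed
  hence inj: "inj_on (\<lambda>x. x \<otimes> x) (carrier R)" using fin by (intro finite_surj_inj)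
  have "\<one> \<otimes> \<one> = \<ominus> \<one> \<otimes> \<ominus> \<one>" by (simp add: l_minus)
  hence "\<one> = \<ominus> \<one>" by (rule inj_onD[OF inj]) simp_all
  thus False using two by (metis one_closed r_neg)
qed

lemma (in comm_group) subgroup_squares:
  assumes "subgroup S G"
  shows "subgroup ((\<lambda>x. x \<otimes> x) ` S) G"
proof -
  interpret h: group_hom G G "\<lambda>x. x \<otimes> x"
    by (intro group_hom.intro group_hom_axioms.intro is_group homI) (simp_all add: m_ac)
  show ?thesis using h.subgroup_img_is_subgroup[OF assms] .
qed

text \<open>An empty product is the trivial group; this removes the second factor when there are no
  conjugate pairs.\<close>

lemma iso_DirProd_cyclic_power_0:
  "A \<times>\<times> cyclic_power m 0 \<cong> A"
proof (rule is_isoI)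
  have "carrier (cyclic_power m 0) = {\<lambda>_. undefined}" by (simp add: cyclic_power_def)
  thus "fst \<in> iso (A \<times>\<times> cyclic_power m 0) A"
    by (auto simp: iso_iff hom_def inj_on_def mult_DirProd')
qed

section \<open>The group of type (8, 2, 2), its characters and its squares\<close>

abbreviation (input) "C8xC2xC2 \<equiv> cyclic 8 \<times>\<times> cyclic 2 \<times>\<times> cyclic 2"

lemma carrier_C8xC2xC2: "carrier C8xC2xC2 = {0..<8} \<times> {0..<2} \<times> {0..<2}"
  by (simp add: carrier_integer_mod_group)

lemma mult_C8xC2xC2:
  "(x, y, z) \<otimes>\<^bsub>C8xC2xC2\<^esub> (x', y', z') = ((x + x') mod 8, (y + y') mod 2, (z + z') mod 2)"
  by simp

lemma comm_group_C8xC2xC2: "comm_group C8xC2xC2"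
proof -
  have "group C8xC2xC2" by (intro DirProd_group group_integer_mod_group)
  thus ?thesis
    by (rule group.group_comm_groupI) (auto simp: carrier_C8xC2xC2 mult_C8xC2xC2 add.commute)
qed

lemma card_C8xC2xC2: "card (carrier C8xC2xC2) = 32"
  unfolding carrier_C8xC2xC2 card_cartesian_product by simp

text \<open>For odd \<open>s\<close>, conjugation fixes the fourth power of \<open>\<zeta>\<close>
  and so sends the character with index (j, k, l) to the one with index (s j, k, l): only the action
  on residues modulo 8 counts. \<open>J1\<close> holds the fixed residues and \<open>J2\<close> one
  residue of each two-element orbit; each occurs with four pairs (k, l).\<close>

lemma (in odd_quadratic_extension) units_C8xC2xC2:
  fixes J1 J2 :: "int set"
  assumes fin: "finite (carrier F)" and q: "card (carrier F) = q"
    and char: "add_pow F (32::nat) \<one> \<noteq> \<zero>"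
    and \<zeta>: "\<zeta> \<in> Units K" "group.ord (units_of K) \<zeta> = 8"
    and conj: "\<And>n::int. conj (\<zeta> [^]\<^bsub>units_of K\<^esub> n) = \<zeta> [^]\<^bsub>units_of K\<^esub> (s * n)"
    and s: "odd s"
    and J: "J1 \<subseteq> {0..<8}" "J2 \<subseteq> {0..<8}" "card J1 + 2 * card J2 = 8"
    and J1: "\<And>j. j \<in> J1 \<Longrightarrow> 8 dvd (s - 1) * j"
    and cover: "\<And>j. j \<in> {0..<8} \<Longrightarrow> j \<in> J1 \<or> j \<in> J2 \<or> (\<exists>i\<in>J2. 8 dvd s * i - j)"
  shows "units_of (group_algebra F C8xC2xC2) \<cong>
      cyclic_power (q - 1) (4 * card J1) \<times>\<times> cyclic_power (q ^ 2 - 1) (4 * card J2)"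
proof -
  interpret K: field K by (rule K_field)
  interpret U: group "units_of K" by (rule K.units_group)
  interpret C: comm_group C8xC2xC2 by (rule comm_group_C8xC2xC2)
  let ?p = "\<lambda>i::int. \<zeta> [^]\<^bsub>units_of K\<^esub> i"
  \<comment> \<open>The exponent of \<open>\<zeta>\<close> in the value of the character (j, k, l)
    at (x, y, z); the factors 4 produce its fourth power, of order 2, on the two factors of order
    2.\<close>
  define n where "n = (\<lambda>(j, k, l) (x, y, z). j * x + 4 * (k * y) + 4 * (l * z) :: int)"
  have \<zeta>c: "\<zeta> \<in> carrier (units_of K)" using \<zeta> by (simp add: units_of_carrier)
  have p_eq: "?p m = ?p m' \<longleftrightarrow> m mod 8 = m' mod 8" for m m'
    unfolding U.int_pow_eq[OF \<zeta>c] \<zeta>(2) by (metis mod_eq_dvd_iff of_nat_numeral)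
  have p_add: "?p (m + m') = ?p m \<otimes>\<^bsub>K\<^esub> ?p m'" for m m'
    using U.int_pow_mult[OF \<zeta>c, of m m'] by (simp add: units_of_mult)
  have p0: "?p 0 = \<one>\<^bsub>K\<^esub>" by (simp add: units_of_one)
  \<comment> \<open>Changing \<open>x\<close> by 8 or \<open>y\<close>, \<open>z\<close> by 2 alters
    the exponent by a multiple of 8, so the reductions in the group law do not affect the
    value.\<close>
  have red: "(j * (x mod 8) + 4 * (k * (y mod 2)) + 4 * (l * (z mod 2))) mod 8 = (j * x + 4 * (k * y) + 4 * (l * z)) mod 8"
    for j k l x y z :: int
  proof -
    have expand: "j * (x' + 8 * a) + 4 * (k * (y' + 2 * b)) + 4 * (l * (z' + 2 * c)) =
        (j * x' + 4 * (k * y') + 4 * (l * z')) + 8 * (j * a + k * b + l * c)" for x' y' z' a b c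
      by (simp add: algebra_simps)
    have "j * x + 4 * (k * y) + 4 * (l * z) =
        (j * (x mod 8) + 4 * (k * (y mod 2)) + 4 * (l * (z mod 2))) + 8 * (j * (x div 8) + k * (y div 2) + l * (z div 2))"
      unfolding expand[symmetric] mod_mult_div_eq ..
    thus ?thesis by (simp only: mod_mult_self2)
  qed
  interpret A: group_algebra_characters F d C8xC2xC2 "\<lambda>j x. ?p (n j x)"
  proof unfold_locales
    show "finite (carrier C8xC2xC2)" unfolding carrier_C8xC2xC2 by simp
    show "finite (carrier F)" by (rule fin)
    show "add_pow F (card (carrier C8xC2xC2)) \<one> \<noteq> \<zero>" unfolding card_C8xC2xC2 by (rule char)
    show "?p (n j x) \<in> carrier K" for j x
      using U.int_pow_closed[OF \<zeta>c] K.Units_closed by (simp add: units_of_carrier)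
    show "?p (n j (x \<otimes>\<^bsub>C8xC2xC2\<^esub> y)) = ?p (n j x) \<otimes>\<^bsub>K\<^esub> ?p (n j y)" for j x y
    proof -
      obtain j1 j2 j3 x1 x2 x3 y1 y2 y3 where [simp]: "j = (j1, j2, j3)" "x = (x1, x2, x3)" "y = (y1, y2, y3)"
        by (metis prod_cases3)
      show ?thesis unfolding p_add[symmetric] p_eq
        by (simp add: n_def red del: mult_DirProd add: mult_C8xC2xC2) (simp add: algebra_simps)
    qed
    show "?p (n (i \<otimes>\<^bsub>C8xC2xC2\<^esub> j) x) = ?p (n i x) \<otimes>\<^bsub>K\<^esub> ?p (n j x)" for i j x
    proof -
      obtain j1 j2 j3 x1 x2 x3 y1 y2 y3 where [simp]: "j = (j1, j2, j3)" "x = (x1, x2, x3)" "i = (y1, y2, y3)"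
        by (metis prod_cases3)
      \<comment> \<open>The exponent is symmetric in index and element, so \<open>red\<close>
        applies with their roles exchanged.\<close>
      have "n (i \<otimes>\<^bsub>C8xC2xC2\<^esub> j) x = x1 * ((y1 + j1) mod 8) + 4 * (x2 * ((y2 + j2) mod 2)) + 4 * (x3 * ((y3 + j3) mod 2))"
        by (simp add: n_def mult.commute)
      thus ?thesis unfolding p_add[symmetric] p_eq
        by (simp add: red) (simp add: n_def algebra_simps)
    qed
    show "?p (n j \<one>\<^bsub>C8xC2xC2\<^esub>) = \<one>\<^bsub>K\<^esub>" for j
      by (cases j) (simp add: n_def units_of_one)
    fix x assume x: "x \<in> carrier C8xC2xC2" "x \<noteq> \<one>\<^bsub>C8xC2xC2\<^esub>"
    obtain x1 x2 x3 where xx: "x = (x1, x2, x3)" by (metis prod_cases3)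
    have r: "x1 \<in> {0..<8}" "x2 \<in> {0..<2}" "x3 \<in> {0..<2}" and ne: "\<not> (x1 = 0 \<and> x2 = 0 \<and> x3 = 0)"
      using x unfolding xx carrier_C8xC2xC2 by auto
    \<comment> \<open>The index with a single 1 at the first nonzero coordinate of \<open>x\<close>
      detects it, with exponent \<open>x1\<close> or 4.\<close>
    have "\<exists>j\<in>carrier C8xC2xC2. n j x mod 8 \<noteq> 0 mod 8"
    proof (cases "x1 = 0")
      case False
      thus ?thesis using r unfolding carrier_C8xC2xC2 by (intro bexI[of _ "(1, 0, 0)"]) (auto simp: n_def xx)
    next
      case True
      show ?thesis
      proof (cases "x2 = 0")
        case False
        hence "x2 = 1" using r by auto
        thus ?thesis using True unfolding carrier_C8xC2xC2 by (intro bexI[of _ "(0, 1, 0)"]) (auto simp: n_def xx)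
      next
        case x2: True
        hence "x3 = 1" using True ne r by auto
        thus ?thesis using True x2 unfolding carrier_C8xC2xC2 by (intro bexI[of _ "(0, 0, 1)"]) (auto simp: n_def xx)
      qed
    qed
    thus "\<exists>j\<in>carrier C8xC2xC2. ?p (n j x) \<noteq> \<one>\<^bsub>K\<^esub>" unfolding p0[symmetric] p_eq .
  qed
  have conj_eq: "conj (?p (n (i, k, l) x)) = ?p (n (j, k, l) x)" if dvd: "8 dvd s * i - j" for i j k l x
  proof -
    obtain x1 x2 x3 where xx: "x = (x1, x2, x3)" by (metis prod_cases3)
    obtain m where m: "s * i - j = 8 * m" using dvd by (elim dvdE)
    obtain t where t: "s = 2 * t + 1" using s by (elim oddE)
    \<comment> \<open>As \<open>s - 1\<close> is even, the terms carrying the factor 4 change only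
      by multiples of 8.\<close>
    have "s * n (i, k, l) x - n (j, k, l) x = (s * i - j) * x1 + 4 * (s - 1) * (k * x2 + l * x3)"
      by (simp add: n_def xx algebra_simps)
    also have "\<dots> = 8 * (m * x1 + t * (k * x2 + l * x3))" unfolding m by (simp add: t algebra_simps)
    finally have "8 dvd s * n (i, k, l) x - n (j, k, l) x" by simp
    thus ?thesis unfolding conj p_eq by (simp add: mod_eq_dvd_iff)
  qed
  let ?B = "{0..<2::int} \<times> {0..<2::int}"
  have finJ: "finite J1" "finite J2" using J finite_subset by blast+
  have "units_of A.F.RG \<cong> cyclic_power (q - 1) (card (J1 \<times> ?B)) \<times>\<times> cyclic_power (q ^ 2 - 1) (card (J2 \<times> ?B))"
  proof (rule A.units_iso_sets)
    show "J1 \<times> ?B \<subseteq> carrier C8xC2xC2" "J2 \<times> ?B \<subseteq> carrier C8xC2xC2" unfolding carrier_C8xC2xC2 using J by auto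
    show "card (carrier C8xC2xC2) = card (J1 \<times> ?B) + 2 * card (J2 \<times> ?B)"
      unfolding card_C8xC2xC2 card_cartesian_product using J(3) by simp
    show "card (carrier F) = q" by (rule q)
    show "conj (?p (n j x)) = ?p (n j x)" if "j \<in> J1 \<times> ?B" for j x
    proof -
      obtain j1 k l where j: "j = (j1, k, l)" "j1 \<in> J1" using \<open>j \<in> J1 \<times> ?B\<close> by auto
      have "8 dvd s * j1 - j1" using J1[OF j(2)] by (simp add: algebra_simps)
      thus ?thesis unfolding j(1) by (rule conj_eq)
    qed
    fix j assume "j \<in> carrier C8xC2xC2"
    then obtain j1 k l where j: "j = (j1, k, l)" "j1 \<in> {0..<8}" "(k, l) \<in> ?B" unfolding carrier_C8xC2xC2 by auto
    from cover[OF j(2)] show "j \<in> J1 \<times> ?B \<or> j \<in> J2 \<times> ?B \<or>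
        (\<exists>i\<in>J2 \<times> ?B. \<forall>x\<in>carrier C8xC2xC2. conj (?p (n i x)) = ?p (n j x))"
    proof (elim disjE)
      assume "\<exists>i\<in>J2. 8 dvd s * i - j1"
      then obtain i where i: "i \<in> J2" "8 dvd s * i - j1" by blast
      have "(i, k, l) \<in> J2 \<times> ?B" using i j by auto
      moreover have "\<forall>x\<in>carrier C8xC2xC2. conj (?p (n (i, k, l) x)) = ?p (n j x)"
        unfolding j(1) using conj_eq[OF i(2)] by blast
      ultimately show ?thesis by blast
    qed (use j in auto)
  qed
  thus ?thesis by (simp add: card_cartesian_product mult.commute)
qed

text \<open>A coordinatewise form, in which repeated squares of the whole group are computed on
  explicit sets of residues.\<close>

lemma squares_C8xC2xC2:
  "(\<lambda>x. x \<otimes>\<^bsub>C8xC2xC2\<^esub> x) ` (A \<times> B \<times> C) =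
    (\<lambda>x. (x + x) mod 8) ` A \<times> (\<lambda>x. (x + x) mod 2) ` B \<times> (\<lambda>x. (x + x) mod 2) ` C"
proof -
  have "(\<lambda>x. x \<otimes>\<^bsub>C8xC2xC2\<^esub> x) =
      (\<lambda>(x, u). ((x + x) mod 8, (\<lambda>(y, z). ((y + y) mod 2, (z + z) mod 2)) u))"
    by (rule ext) (auto simp only: split_paired_all prod.case mult_C8xC2xC2)
  thus ?thesis by (simp only: image_paired_Times)
qed

theorem theorem3p4:
  fixes F :: "('a, 'm) ring_scheme" and p n q :: nat
  assumes "Factorial_Ring.prime p" and "n \<ge> 1"
    and "field F" and "finite (carrier F)" and "ring_characteristic F = p"
    and "q = p ^ n" and "card (carrier F) = q"
  defines "U \<equiv> units_of (group_algebra F (cyclic 8 \<times>\<times> cyclic 2 \<times>\<times> cyclic 2))"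
  shows "(p = 2 \<longrightarrow>
            U \<cong> cyclic_power 8 n \<times>\<times> cyclic_power 4 n \<times>\<times> cyclic_power 2 (26 * n)
                  \<times>\<times> cyclic (2 ^ n - 1))
       \<and> (p \<noteq> 2 \<longrightarrow>
            ([int q = 1] (mod 8) \<longrightarrow> U \<cong> cyclic_power (p ^ n - 1) 32)
          \<and> ([int q = -1] (mod 8) \<longrightarrow>
               U \<cong> cyclic_power (p ^ n - 1) 8 \<times>\<times> cyclic_power (p ^ (2 * n) - 1) 12)
          \<and> ([int q = 3] (mod 8) \<longrightarrow>
               U \<cong> cyclic_power (p ^ n - 1) 8 \<times>\<times> cyclic_power (p ^ (2 * n) - 1) 12)
          \<and> ([int q = -3] (mod 8) \<longrightarrow>
               U \<cong> cyclic_power (p ^ n - 1) 16 \<times>\<times> cyclic_power (p ^ (2 * n) - 1) 8))"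
proof -
  interpret F: field F by fact
  \<comment> \<open>The characteristic is the additive order of 1, so \<open>p\<close> decides which
    multiples of 1 vanish; the multiples 2 and 32 matter below.\<close>
  have char: "add_pow F m \<one>\<^bsub>F\<^esub> = \<zero>\<^bsub>F\<^esub> \<longleftrightarrow> p dvd m" for m :: nat
    using F.add.pow_eq_id[OF F.one_closed, of m] assms(5) by (simp add: ring_characteristic_def)
  have two: "add_pow F (2::nat) \<one>\<^bsub>F\<^esub> = \<one>\<^bsub>F\<^esub> \<oplus>\<^bsub>F\<^esub> \<one>\<^bsub>F\<^esub>"
    by (simp add: numeral_2_eq_2)
  have octal: "{0..<8::int} = {0, 1, 2, 3, 4, 5, 6, 7}" by auto
  have binary: "{0..<2::int} = {0, 1}" by auto
  show ?thesis
  proof (intro conjI impI)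
    assume p: "p = 2"
    interpret C: comm_group C8xC2xC2 by (rule comm_group_C8xC2xC2)
    interpret A: char2_group_algebra F C8xC2xC2
    proof unfold_locales
      show "finite (carrier C8xC2xC2)" unfolding carrier_C8xC2xC2 by simp
      show "finite (carrier F)" by fact
      show "\<one>\<^bsub>F\<^esub> \<oplus>\<^bsub>F\<^esub> \<one>\<^bsub>F\<^esub> = \<zero>\<^bsub>F\<^esub>" using char[of 2] two p by simp
    qed
    \<comment> \<open>Doubling modulo 8 takes all residues to the even ones, these to 0 and 4, and
      these to 0, while the factors of order 2 collapse at once: the chain has sizes 32, 4, 2,
      1.\<close>
    let ?G1 = "{0, 2, 4, 6::int} \<times> {0::int} \<times> {0::int}" and ?G2 = "{0, 4::int} \<times> {0::int} \<times> {0::int}"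
    have G1: "(\<lambda>x. x \<otimes>\<^bsub>C8xC2xC2\<^esub> x) ` carrier C8xC2xC2 = ?G1"
      unfolding carrier_C8xC2xC2 squares_C8xC2xC2 octal binary by auto
    have G2: "(\<lambda>x. x \<otimes>\<^bsub>C8xC2xC2\<^esub> x) ` ?G1 = ?G2"
      unfolding squares_C8xC2xC2 by auto
    have G3: "(\<lambda>x. x \<otimes>\<^bsub>C8xC2xC2\<^esub> x) ` ?G2 = {\<one>\<^bsub>C8xC2xC2\<^esub>}"
      unfolding squares_C8xC2xC2 by auto
    have s1: "subgroup ?G1 C8xC2xC2" using C.subgroup_squares[OF C.subgroup_self] unfolding G1 .
    have s2: "subgroup ?G2 C8xC2xC2" using C.subgroup_squares[OF s1] unfolding G2 .
    have "card (carrier F) = 2 ^ n" using assms p by simp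
    thus "U \<cong> cyclic_power 8 n \<times>\<times> cyclic_power 4 n \<times>\<times> cyclic_power 2 (26 * n) \<times>\<times> cyclic (2 ^ n - 1)"
      unfolding U_def
      by (rule A.units_of_RG_C8_C4_C2[OF _ G1 G2 G3 s1 s2 card_C8xC2xC2]) (simp_all add: card_cartesian_product)
  next
    assume p: "p \<noteq> 2"
    have np: "\<not> p dvd 2" using assms(1) p by (metis primes_dvd_imp_eq two_is_prime_nat)
    hence oq: "odd q" using assms(1,6) p by (simp add: prime_odd_nat prime_ge_2_nat le_neq_implies_less)
    have "\<not> p dvd 2 ^ 5" using np assms(1) prime_dvd_power by blast
    hence c32: "add_pow F (32::nat) \<one>\<^bsub>F\<^esub> \<noteq> \<zero>\<^bsub>F\<^esub>" using char by simp
    have c2: "\<one>\<^bsub>F\<^esub> \<oplus>\<^bsub>F\<^esub> \<one>\<^bsub>F\<^esub> \<noteq> \<zero>\<^bsub>F\<^esub>" using char[of 2] two np by simp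
    obtain d where d: "d \<in> carrier F" "\<forall>x\<in>carrier F. x \<otimes>\<^bsub>F\<^esub> x \<noteq> d"
      using F.exists_nonsquare[OF assms(4) c2] by blast
    interpret Q: odd_quadratic_extension F d
      by unfold_locales (use d c2 in auto)
    obtain \<zeta> s where \<zeta>: "\<zeta> \<in> Units Q.K" "group.ord (units_of Q.K) \<zeta> = 8" and s: "s \<in> {0..<8}"
      and conj: "\<And>n::int. Q.conj (\<zeta> [^]\<^bsub>units_of Q.K\<^esub> n) = \<zeta> [^]\<^bsub>units_of Q.K\<^esub> (s * n)"
      and sq: "\<And>n::int. 8 dvd (s - 1) * n \<longleftrightarrow> 8 dvd (int q - 1) * n"
      using Q.eighth_root[OF assms(4,7) oq] by blast
    have q2: "q ^ 2 = p ^ (2 * n)" using assms(6) by (simp add: power_mult[symmetric] mult.commute)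
    have units: "U \<cong> cyclic_power (p ^ n - 1) (4 * card J1) \<times>\<times> cyclic_power (p ^ (2 * n) - 1) (4 * card J2)"
      if "odd s" "J1 \<subseteq> {0..<8}" "J2 \<subseteq> {0..<8}" "card J1 + 2 * card J2 = 8"
        "\<And>j. j \<in> J1 \<Longrightarrow> 8 dvd (s - 1) * j"
        "\<And>j. j \<in> {0..<8} \<Longrightarrow> j \<in> J1 \<or> j \<in> J2 \<or> (\<exists>i\<in>J2. 8 dvd s * i - j)" for J1 J2
      using Q.units_C8xC2xC2[OF assms(4,7) c32 \<zeta> conj that] unfolding U_def q2 assms(6)[symmetric] .
    \<comment> \<open>Multiplication by 3 and by 7 modulo 8 each have two fixed residues and three
      pairs, so it does not matter which of the two values \<open>s\<close> has.\<close>
    have three_mod_four: "U \<cong> cyclic_power (p ^ n - 1) 8 \<times>\<times> cyclic_power (p ^ (2 * n) - 1) 12"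
      if "s = 3 \<or> s = 7"
      using that
    proof
      assume s3: "s = 3"
      \<comment> \<open>Multiplication by 3 fixes 0 and 4 and exchanges 1 with 3, 2 with 6 and 5
        with 7.\<close>
      have "U \<cong> cyclic_power (p ^ n - 1) (4 * card {0, 4::int}) \<times>\<times> cyclic_power (p ^ (2 * n) - 1) (4 * card {1, 2, 5::int})"
        unfolding s3 by (rule units) (auto simp: octal s3)
      thus ?thesis by simp
    next
      assume s7: "s = 7"
      \<comment> \<open>Multiplication by 7 is negation: it fixes 0 and 4 and exchanges 1 with 7, 2
        with 6 and 3 with 5.\<close>
      have "U \<cong> cyclic_power (p ^ n - 1) (4 * card {0, 4::int}) \<times>\<times> cyclic_power (p ^ (2 * n) - 1) (4 * card {1, 2, 3::int})"
        by (rule units) (auto simp: octal s7)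
      thus ?thesis by simp
    qed
    \<comment> \<open>The multipliers 1, 2, 4 compare the divisibility of \<open>s - 1\<close> and
      \<open>q - 1\<close> by 8, 4 and 2, which leaves just one candidate for \<open>s\<close>, or
      the pair 3 and 7.\<close>
    have s_mult: "8 dvd s - 1 \<longleftrightarrow> 8 dvd int q - 1" "8 dvd (s - 1) * 2 \<longleftrightarrow> 8 dvd (int q - 1) * 2"
       "8 dvd (s - 1) * 4 \<longleftrightarrow> 8 dvd (int q - 1) * 4"
      using sq[of 1] sq[of 2] sq[of 4] by simp_all
    show "U \<cong> cyclic_power (p ^ n - 1) 32" if "[int q = 1] (mod 8)"
    proof -
      have "int q mod 8 = 1" using that by (simp add: cong_def)
      hence s1: "s = 1" using s s_mult by (simp only: atLeastLessThan_iff) presburger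
      \<comment> \<open>For \<open>s = 1\<close> all eight residues are fixed and no pair is
        left.\<close>
      have "U \<cong> cyclic_power (p ^ n - 1) (4 * card {0..<8::int}) \<times>\<times> cyclic_power (p ^ (2 * n) - 1) (4 * card ({}::int set))"
        by (rule units) (auto simp: s1)
      hence "U \<cong> cyclic_power (p ^ n - 1) 32 \<times>\<times> cyclic_power (p ^ (2 * n) - 1) 0" by simp
      also have "\<dots> \<cong> cyclic_power (p ^ n - 1) 32" by (rule iso_DirProd_cyclic_power_0)
      finally show ?thesis .
    qed
    show "U \<cong> cyclic_power (p ^ n - 1) 8 \<times>\<times> cyclic_power (p ^ (2 * n) - 1) 12" if "[int q = - 1] (mod 8)"
    proof (rule three_mod_four)
      have "int q mod 8 = 7" using that by (simp add: cong_def)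
      thus "s = 3 \<or> s = 7" using s s_mult by (simp only: atLeastLessThan_iff) presburger
    qed
    show "U \<cong> cyclic_power (p ^ n - 1) 8 \<times>\<times> cyclic_power (p ^ (2 * n) - 1) 12" if "[int q = 3] (mod 8)"
    proof (rule three_mod_four)
      have "int q mod 8 = 3" using that by (simp add: cong_def)
      thus "s = 3 \<or> s = 7" using s s_mult by (simp only: atLeastLessThan_iff) presburger
    qed
    show "U \<cong> cyclic_power (p ^ n - 1) 16 \<times>\<times> cyclic_power (p ^ (2 * n) - 1) 8" if "[int q = - 3] (mod 8)"
    proof -
      have "int q mod 8 = 5" using that by (simp add: cong_def)
      hence s5: "s = 5" using s s_mult by (simp only: atLeastLessThan_iff) presburger
      \<comment> \<open>Multiplication by 5 fixes the even residues and exchanges 1 with 5 and 3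
        with 7.\<close>
      have "U \<cong> cyclic_power (p ^ n - 1) (4 * card {0, 2, 4, 6::int}) \<times>\<times> cyclic_power (p ^ (2 * n) - 1) (4 * card {1, 3::int})"
        by (rule units) (auto simp: octal s5)
      thus ?thesis by simp
    qed
  qed
qed

end
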